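(* Let $\mathbb{K}$ be a field of characteristic $0$, let $k\ge 2$ and $r=2k$. Then for all sufficiently large $t$ (depending on $k$) the following holds: if $S=\mathbb{K}[x_1,\ldots,x_r]$ and $I=\langle l_1^t,\ldots,l_{r+1}^t\rangle$ with $l_1,\ldots,l_{r+1}\in S_1$ generic linear forms, then the Weak Lefschetz Property fails for $A=S/I$ in degree $c=\frac{r}{2}(t-1)-1$; that is, there is no linear form $\ell\in S_1$ for which the multiplication map $A_c\xrightarrow{\ \cdot\ell\ }A_{c+1}$ is injective or surjective.
   Context: $S$ has the standard grading, and $A_j$ denotes the degree-$j$ graded piece of $A$. An Artinian graded quotient $A$ of $S$ has the Weak Lefschetz Property if there is $\ell\in S_1$ such that for all $m$ the map $A_m\xrightarrow{\cdot\ell}A_{m+1}$ is injective or surjective. A statement about generic linear forms $l_1,\ldots,l_{r+1}$ means that (for the given $r$ and $t$) it holds for all tuples in some nonempty Zariski-open subset of $(S_1)^{r+1}$. *)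

theory Defs
  imports "HOL-Algebra.QuotRing" "HOL-Library.Poly_Mapping" "HOL-Library.FuncSet"
begin

type_synonym ('v, 'a) mpoly = "('v \<Rightarrow>\<^sub>0 nat) \<Rightarrow>\<^sub>0 'a"

definition indets :: "('v, 'a::zero) mpoly \<Rightarrow> 'v set" where
  "indets p = (\<Union>m\<in>Poly_Mapping.keys p. Poly_Mapping.keys m)"

definition mdegree :: "('v \<Rightarrow>\<^sub>0 nat) \<Rightarrow> nat" where
  "mdegree m = (\<Sum>v\<in>Poly_Mapping.keys m. Poly_Mapping.lookup m v)"

definition eval_mpoly :: "('v \<Rightarrow> 'a) \<Rightarrow> ('v, 'a::comm_semiring_1) mpoly \<Rightarrow> 'a" where
  "eval_mpoly x p = (\<Sum>m\<in>Poly_Mapping.keys p. Poly_Mapping.lookup p m * (\<Prod>v\<in>Poly_Mapping.keys m. x v ^ Poly_Mapping.lookup m v))"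

text \<open>The ring $K[x_0, \dots, x_{r-1}]$, where $K$ is the coefficient type.  It is cut out of the
  ring of polynomials in countably many variables, so that \<open>r\<close> is an ordinary natural number.\<close>

definition poly_ring :: "nat \<Rightarrow> (nat, 'a::comm_ring_1) mpoly ring" where
  "poly_ring r = \<lparr>carrier = {p. indets p \<subseteq> {..<r}}, mult = (*), one = 1, zero = 0, add = (+)\<rparr>"

lemma indets_add: "indets (p + q) \<subseteq> indets p \<union> indets q"
  using Poly_Mapping.keys_add[of p q] unfolding indets_def by blast

lemma indets_mult: "indets (p * q) \<subseteq> indets p \<union> indets q"
proof
  fix v assume "v \<in> indets (p * q)"
  then obtain m where m: "m \<in> Poly_Mapping.keys (p * q)" "v \<in> Poly_Mapping.keys m"
    unfolding indets_def by blast
  obtain a b where "m = a + b" "a \<in> Poly_Mapping.keys p" "b \<in> Poly_Mapping.keys q"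
    using keys_mult[of p q] m(1) by blast
  with m(2) Poly_Mapping.keys_add[of a b] show "v \<in> indets p \<union> indets q"
    unfolding indets_def by blast
qed

lemma cring_poly_ring: "cring (poly_ring r :: (nat, 'a::comm_ring_1) mpoly ring)"
proof (rule cringI)
  show "abelian_group (poly_ring r :: (nat, 'a) mpoly ring)"
  proof (rule abelian_groupI)
    fix p :: "(nat, 'a) mpoly" assume "p \<in> carrier (poly_ring r)"
    then have "- p \<in> carrier (poly_ring r)" "- p + p = 0"
      by (auto simp: poly_ring_def indets_def in_keys_iff)
    then show "\<exists>q\<in>carrier (poly_ring r). q \<oplus>\<^bsub>poly_ring r\<^esub> p = \<zero>\<^bsub>poly_ring r\<^esub>"
      by (auto simp: poly_ring_def)
  next
    fix p q :: "(nat, 'a) mpoly"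
    assume "p \<in> carrier (poly_ring r)" "q \<in> carrier (poly_ring r)"
    then show "p \<oplus>\<^bsub>poly_ring r\<^esub> q \<in> carrier (poly_ring r)"
      using indets_add[of p q] by (auto simp: poly_ring_def)
  qed (auto simp: poly_ring_def indets_def ac_simps)
  show "Group.comm_monoid (poly_ring r :: (nat, 'a) mpoly ring)"
  proof (rule comm_monoidI)
    fix p q :: "(nat, 'a) mpoly"
    assume "p \<in> carrier (poly_ring r)" "q \<in> carrier (poly_ring r)"
    then show "p \<otimes>\<^bsub>poly_ring r\<^esub> q \<in> carrier (poly_ring r)"
      using indets_mult[of p q] by (auto simp: poly_ring_def)
  qed (auto simp: poly_ring_def indets_def ac_simps)
qed (auto simp: poly_ring_def distrib_right)

definition homogeneous_part :: "nat \<Rightarrow> nat \<Rightarrow> (nat, 'a::comm_ring_1) mpoly set" where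
  "homogeneous_part r d = {p \<in> carrier (poly_ring r). \<forall>m\<in>Poly_Mapping.keys p. mdegree m = d}"

text \<open>The graded piece $A_d$ of $A = S/I$ (for a homogeneous ideal \<open>I\<close> of \<open>S = poly_ring r\<close>) is the
  image of $S_d$ in \<open>A\<close>.\<close>

definition quot_part ::
    "nat \<Rightarrow> (nat, 'a::comm_ring_1) mpoly set \<Rightarrow> nat \<Rightarrow> (nat, 'a) mpoly set set" where
  "quot_part r I d = (\<lambda>f. I +>\<^bsub>poly_ring r\<^esub> f) ` homogeneous_part r d"

definition mult_map ::
    "nat \<Rightarrow> (nat, 'a::comm_ring_1) mpoly set \<Rightarrow> (nat, 'a) mpoly
      \<Rightarrow> (nat, 'a) mpoly set \<Rightarrow> (nat, 'a) mpoly set" where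
  "mult_map r I f a = (I +>\<^bsub>poly_ring r\<^esub> f) \<otimes>\<^bsub>poly_ring r Quot I\<^esub> a"

definition weak_lefschetz_in_degree ::
    "nat \<Rightarrow> (nat, 'a::comm_ring_1) mpoly set \<Rightarrow> nat \<Rightarrow> bool" where
  "weak_lefschetz_in_degree r I m \<longleftrightarrow>
     (\<exists>f \<in> homogeneous_part r 1.
        inj_on (mult_map r I f) (quot_part r I m) \<or>
        mult_map r I f ` quot_part r I m = quot_part r I (Suc m))"

definition power_ideal ::
    "nat \<Rightarrow> nat \<Rightarrow> nat \<Rightarrow> (nat \<Rightarrow> (nat, 'a::comm_ring_1) mpoly) \<Rightarrow> (nat, 'a) mpoly set" where
  "power_ideal r s t l = Idl\<^bsub>poly_ring r\<^esub> ((\<lambda>i. l i ^ t) ` {..<s})"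

definition linear_form_tuples :: "nat \<Rightarrow> nat \<Rightarrow> (nat \<Rightarrow> (nat, 'a::comm_ring_1) mpoly) set" where
  "linear_form_tuples r s = ({..<s} \<rightarrow>\<^sub>E homogeneous_part r 1)"

text \<open>The Zariski topology on $(S_1)^s \cong K^{s \times r}$: the coordinate \<open>(i, j)\<close> of a tuple \<open>l\<close>
  is the coefficient of $x_j$ in \<open>l i\<close>, and the open sets are the complements of common zero sets
  of arbitrary families of polynomials in these coordinates.\<close>

definition tuple_coords :: "(nat \<Rightarrow> (nat, 'a::zero) mpoly) \<Rightarrow> nat \<times> nat \<Rightarrow> 'a" where
  "tuple_coords l = (\<lambda>(i, j). Poly_Mapping.lookup (l i) (Poly_Mapping.single j 1))"

definition zariski_open :: "nat \<Rightarrow> nat \<Rightarrow> (nat \<Rightarrow> (nat, 'a::comm_ring_1) mpoly) set \<Rightarrow> bool" where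
  "zariski_open r s U \<longleftrightarrow>
     (\<exists>F :: (nat \<times> nat, 'a) mpoly set.
        (\<forall>p\<in>F. indets p \<subseteq> {..<s} \<times> {..<r}) \<and>
        U = linear_form_tuples r s
              - {l \<in> linear_form_tuples r s. \<forall>p\<in>F. eval_mpoly (tuple_coords l) p = 0})"

definition for_generic_forms ::
    "nat \<Rightarrow> nat \<Rightarrow> ((nat \<Rightarrow> (nat, 'a::comm_ring_1) mpoly) \<Rightarrow> bool) \<Rightarrow> bool" where
  "for_generic_forms r s P \<longleftrightarrow> (\<exists>U. zariski_open r s U \<and> U \<noteq> {} \<and> (\<forall>l\<in>U. P l))"

end

(*
  After a linear change of coordinates, l_1, ..., l_r are the variables and l_(r+1) is their sum L.
  Put m = t - 1, so that the degree c + 1 = km is the middle degree of B = K[x]/(x_1^t, ..., x_r^t).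

  Multiplication by a linear form is not surjective: modulo it, S becomes a polynomial ring in 2k - 1
  variables, and by apolarity a nonzero element of degree km in the cokernel amounts to a form of degree
  km that vanishes to order (k - 1)m at 2k + 1 points of P^(2k-2). These points lie on a rational normal
  curve, whose secant variety is a hypersurface of degree k with multiplicity k - 1 along the curve;
  the m-th power of its equation is such a form.

  It is not injective because dim A_c > dim A_(c+1). By the sl_2-action on B, multiplication by L is
  injective on B below the middle degree, so with b_j = dim B_(km-j) the claim becomes
  b_0 - b_1 < b_t - b_(t+1), an inequality between box-bounded compositions that is proved by induction
  on k.
*)

theory Submission
  imports Defs "HOL-Computational_Algebra.Formal_Laurent_Series" "Jordan_Normal_Form.Determinant"
begin

section \<open>Polynomials, derivations and the apolarity pairing\<close>

text \<open>Write l = \<Sum> c_i x_i and s_i = 1 / c_i. The points are the classes of e_1, ..., e_r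
  and (1, ..., 1) in K^r / K c, and the secant equation becomes the determinant G(y) of the Hankel
  matrix with entries \<Sum>_i y_i w_i s_i^(a+b), a, b < k. The weights w_i = s_i / \<Prod>_(j
  \<noteq> i) (s_i - s_j) are chosen to fit Lagrange's identities: moving y along c changes no
  entry, moving along (1, ..., 1) changes only the corner a = b = k - 1, and moving along e_i adds a
  matrix of rank one. So G is constant along c and affine along the other r + 1 directions, and G^m
  has degree at most m along each of them, which is the vanishing order wanted. This is verified on
  the coefficients of G, all of whose monomials are squarefree. The obstacle is that failure is
  claimed for every l, also with zero or equal c_i, where the formula breaks down; a limit of secant
  equations takes over. The dimension count chooses no basis of A: a linear map between spans of
  monomials is shown to have a kernel.\<close>

abbreviation lookup :: "('k \<Rightarrow>\<^sub>0 'c::zero) \<Rightarrow> 'k \<Rightarrow> 'c" where "lookup \<equiv> Poly_Mapping.lookup"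
abbreviation keys :: "('k \<Rightarrow>\<^sub>0 'c::zero) \<Rightarrow> 'k set" where "keys \<equiv> Poly_Mapping.keys"
abbreviation single :: "'k \<Rightarrow> 'c::zero \<Rightarrow> 'k \<Rightarrow>\<^sub>0 'c" where "single \<equiv> Poly_Mapping.single"
abbreviation expo :: "'v \<Rightarrow> 'v \<Rightarrow>\<^sub>0 nat" where "expo i \<equiv> Poly_Mapping.single i (Suc 0)"

definition var :: "'v \<Rightarrow> ('v, 'a::comm_ring_1) mpoly" where "var i = single (expo i) 1"
definition const :: "'a \<Rightarrow> ('v, 'a::comm_ring_1) mpoly" where "const c = single 0 c"

section \<open>Coefficients and monomials\<close>

lemma poly_mapping_sum_single: "p = (\<Sum>\<alpha>\<in>keys p. single \<alpha> (lookup p \<alpha>))"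
  by (rule poly_mapping_eqI) (auto simp: lookup_sum lookup_single when_def sum.delta in_keys_iff)

lemma poly_mapping_additive_induct [case_names zero add single]:
  assumes "P 0" "\<And>p q. P p \<Longrightarrow> P q \<Longrightarrow> P (p + q)" "\<And>\<alpha> c. P (single \<alpha> c)"
  shows "P (p :: 'k \<Rightarrow>\<^sub>0 'c::comm_monoid_add)"
proof -
  have "P (\<Sum>\<alpha>\<in>S. single \<alpha> (f \<alpha>))" if "finite S" for S and f :: "'k \<Rightarrow> 'c"
    using that by induction (auto intro: assms)
  then show ?thesis
    by (subst poly_mapping_sum_single) auto
qed

lemma lookup_single_mult_add:
  "lookup (single \<beta> c * p) (\<beta> + \<gamma>) = c * lookup (p :: ('v, 'a::comm_ring_1) mpoly) \<gamma>"
  by (simp add: lookup_mult lookup_single when_mult)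

lemma lookup_single_mult_eq_0:
  "(\<And>\<gamma>. \<alpha> \<noteq> \<beta> + \<gamma>) \<Longrightarrow> lookup (single \<beta> c * (p :: ('v, 'a::comm_ring_1) mpoly)) \<alpha> = 0"
  by (simp add: lookup_mult lookup_single when_mult)

lemma lookup_const_mult [simp]: "lookup (const c * p) \<alpha> = c * lookup p \<alpha>"
  using lookup_single_mult_add[of 0 c p \<alpha>] by (simp add: const_def)

lemma lookup_mult_const [simp]: "lookup (p * const c) \<alpha> = lookup p \<alpha> * c"
  by (metis lookup_const_mult mult.commute)

lemma expo_add_diff: "lookup \<alpha> i \<noteq> 0 \<Longrightarrow> expo i + (\<alpha> - expo i) = \<alpha>"
  by (rule poly_mapping_eqI) (auto simp: lookup_add lookup_minus lookup_single when_def)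

lemma lookup_var_mult:
  "lookup (var i * p) \<alpha> = (if lookup \<alpha> i = 0 then 0 else lookup p (\<alpha> - expo i))"
proof (cases "lookup \<alpha> i = 0")
  case True
  have "\<alpha> \<noteq> expo i + \<gamma>" for \<gamma>
    using True by (auto simp: lookup_add)
  then show ?thesis
    using True lookup_single_mult_eq_0[of \<alpha> "expo i" 1 p] by (simp add: var_def)
next
  case False
  show ?thesis
    using lookup_single_mult_add[of "expo i" 1 p "\<alpha> - expo i"] False
    by (simp add: var_def expo_add_diff)
qed

lemma const_0 [simp]: "const 0 = 0" and const_1 [simp]: "const 1 = 1"
  and const_add: "const (a + b) = const a + const b"
  and const_mult: "const (a * b) = const a * const b"
  and const_uminus: "const (- a) = - const a"
  by (simp_all add: const_def single_add mult_single single_uminus)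

lemma const_mult_single: "const a * single \<alpha> b = single \<alpha> (a * b)"
  by (simp add: const_def mult_single)

lemma const_of_nat: "const (of_nat n) = of_nat n"
  by (induction n) (simp_all add: const_add)

lemma var_mult_single: "var i * single \<alpha> a = single (expo i + \<alpha>) a"
  by (simp add: var_def mult_single)

section \<open>Formal partial derivatives\<close>

definition pd :: "'v \<Rightarrow> ('v, 'a::comm_ring_1) mpoly \<Rightarrow> ('v, 'a) mpoly" where
  "pd i p = Abs_poly_mapping (\<lambda>\<alpha>. of_nat (Suc (lookup \<alpha> i)) * lookup p (\<alpha> + expo i))"

lemma lookup_pd: "lookup (pd i p) \<alpha> = of_nat (Suc (lookup \<alpha> i)) * lookup p (\<alpha> + expo i)"
proof -
  have "finite ((\<lambda>\<alpha>. \<alpha> + expo i) -` keys p)"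
    by (rule finite_vimageI) (auto simp: inj_def)
  moreover have "{\<alpha>. of_nat (Suc (lookup \<alpha> i)) * lookup p (\<alpha> + expo i) \<noteq> 0}
      \<subseteq> (\<lambda>\<alpha>. \<alpha> + expo i) -` keys p"
    by (auto simp: in_keys_iff)
  ultimately have "finite {\<alpha>. of_nat (Suc (lookup \<alpha> i)) * lookup p (\<alpha> + expo i) \<noteq> 0}"
    using finite_subset by blast
  then show ?thesis
    unfolding pd_def by (subst lookup_Abs_poly_mapping) auto
qed

lemma pd_0 [simp]: "pd i 0 = 0"
  and pd_add: "pd i (p + q) = pd i p + pd i q"
  by (rule poly_mapping_eqI; simp add: lookup_pd lookup_add lookup_minus algebra_simps)+

lemma pd_sum: "pd i (sum f A) = (\<Sum>a\<in>A. pd i (f a))"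
  by (induction A rule: infinite_finite_induct) (auto simp: pd_add)

lemma pd_single: "pd i (single \<alpha> c) = single (\<alpha> - expo i) (of_nat (lookup \<alpha> i) * c)"
proof (rule poly_mapping_eqI)
  fix \<beta>
  show "lookup (pd i (single \<alpha> c)) \<beta> = lookup (single (\<alpha> - expo i) (of_nat (lookup \<alpha> i) * c)) \<beta>"
  proof (cases "lookup \<alpha> i = 0")
    case True
    then have "\<alpha> \<noteq> \<beta> + expo i" by (auto simp: lookup_add)
    with True show ?thesis by (simp add: lookup_pd lookup_single)
  next
    case False
    then have "\<alpha> = \<beta> + expo i \<longleftrightarrow> \<alpha> - expo i = \<beta>"
      by (metis expo_add_diff add.commute add_diff_cancel_right')
    moreover have "lookup (\<beta> + expo i) i = Suc (lookup \<beta> i)" by (simp add: lookup_add)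
    ultimately show ?thesis by (auto simp: lookup_pd lookup_single when_def)
  qed
qed

lemma pd_var: "pd i (var j) = (if i = j then 1 else 0)"
  by (simp add: var_def pd_single lookup_single when_def)

lemma pd_mult: "pd i (p * q) = pd i p * q + p * pd i q"
proof (induction p rule: poly_mapping_additive_induct)
  case (add p p')
  then show ?case by (simp add: pd_add algebra_simps)
next
  case (single \<alpha> a)
  show ?case
  proof (induction q rule: poly_mapping_additive_induct)
    case (add p p')
    then show ?case by (simp add: pd_add algebra_simps)
  next
    case (single \<beta> b)
    have 1: "single (\<alpha> + \<beta> - expo i) (of_nat (lookup \<alpha> i) * x) = single (\<alpha> - expo i + \<beta>) (of_nat (lookup \<alpha> i) * x)"
      for x :: 'b
    proof (cases "lookup \<alpha> i = 0")
      case False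
      then obtain \<gamma> where "\<alpha> = expo i + \<gamma>" by (metis expo_add_diff)
      then show ?thesis by (simp add: add.assoc)
    qed simp
    have 2: "single (\<alpha> + \<beta> - expo i) (of_nat (lookup \<beta> i) * x) = single (\<alpha> + (\<beta> - expo i)) (of_nat (lookup \<beta> i) * x)"
      for x :: 'b
    proof (cases "lookup \<beta> i = 0")
      case False
      then obtain \<gamma> where "\<beta> = expo i + \<gamma>" by (metis expo_add_diff)
      then show ?thesis by (simp add: add.left_commute[of \<alpha>])
    qed simp
    show ?case using 1[of "a*b"] 2[of "a*b"]
      by (simp add: mult_single pd_single lookup_add distrib_right distrib_left single_add mult.assoc mult.left_commute)
  qed simp
qed simp

section \<open>Derivations along which a polynomial is affine\<close>

definition derivation :: "('r::comm_ring_1 \<Rightarrow> 'r) \<Rightarrow> bool" where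
  "derivation D \<longleftrightarrow> (\<forall>p q. D (p + q) = D p + D q) \<and> (\<forall>p q. D (p * q) = D p * q + p * D q)"

lemma derivation_add: "derivation D \<Longrightarrow> D (p + q) = D p + D q"
  and derivation_mult: "derivation D \<Longrightarrow> D (p * q) = D p * q + p * D q"
  unfolding derivation_def by blast+

lemma derivation_0: "derivation D \<Longrightarrow> D 0 = 0"
  using derivation_add[of D 0 0] by simp

lemma derivation_1: "derivation D \<Longrightarrow> D 1 = 0"
  using derivation_mult[of D 1 1] by simp

lemma derivation_of_nat_mult: "derivation D \<Longrightarrow> D (of_nat n * p) = of_nat n * D p"
  by (induction n) (simp_all add: derivation_0 derivation_add distrib_right)

lemma derivation_funpow_0: "derivation D \<Longrightarrow> (D ^^ n) 0 = 0"
  by (induction n) (simp_all add: derivation_0)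

text \<open>The Leibniz expansion stops after the first order, because all higher powers of
  \<open>D\<close> kill \<open>G\<close>.\<close>

lemma derivation_funpow_mult:
  assumes D: "derivation D" and G: "D (D G) = 0"
  shows "(D ^^ n) (G * H) = G * (D ^^ n) H + of_nat n * (D G * (D ^^ (n - 1)) H)"
proof (induction n)
  case (Suc n)
  define K where "K = (D ^^ n) H"
  have 1: "D (D G * (D ^^ (n - 1)) H) = D G * D ((D ^^ (n - 1)) H)"
    by (simp add: derivation_mult[OF D] G)
  \<comment> \<open>The truncated \<open>n - 1\<close> is harmless: at \<open>n = 0\<close> the
    coefficient vanishes, and otherwise one more \<open>D\<close> turns \<open>D ^^ (n - 1)\<close>
    into \<open>D ^^ n\<close>.\<close>
  have 2: "of_nat n * (D G * D ((D ^^ (n - 1)) H)) = of_nat n * (D G * K)"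
    unfolding K_def by (cases n) auto
  have "(D ^^ Suc n) (G * H) = D (G * K) + of_nat n * D (D G * (D ^^ (n - 1)) H)"
    by (simp add: Suc K_def derivation_add[OF D] derivation_of_nat_mult[OF D])
  also have "\<dots> = G * D K + of_nat (Suc n) * (D G * K)"
    unfolding 1 2 by (simp add: derivation_mult[OF D] algebra_simps)
  finally show ?case by (simp add: K_def)
qed simp

text \<open>\<open>G\<close> behaves like an affine function along \<open>D\<close>, so
  \<open>G ^ m\<close> has degree at most \<open>m\<close> in that direction. Here the exponent t =
  m + 1 of the power ideal meets the m-th power of the secant equation.\<close>

lemma derivation_funpow_power_eq_0:
  assumes D: "derivation D" and G: "D (D G) = 0"
  shows "n > m \<Longrightarrow> (D ^^ n) (G ^ m) = 0"
proof (induction m arbitrary: n)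
  case 0
  then show ?case
    by (cases n) (simp_all add: funpow_swap1 derivation_1[OF D] derivation_funpow_0[OF D])
next
  case (Suc m)
  then have "n > m" "n - 1 > m" by auto
  with Suc.IH show ?case by (simp add: derivation_funpow_mult[OF D G])
qed

definition linform :: "nat \<Rightarrow> (nat \<Rightarrow> 'a) \<Rightarrow> (nat, 'a::comm_ring_1) mpoly" where
  "linform r c = (\<Sum>i<r. const (c i) * var i)"

definition dirder :: "nat \<Rightarrow> (nat \<Rightarrow> 'a) \<Rightarrow> (nat, 'a::comm_ring_1) mpoly \<Rightarrow> (nat, 'a) mpoly" where
  "dirder r c p = (\<Sum>i<r. const (c i) * pd i p)"

lemma derivation_pd: "derivation (pd i)"
  by (simp add: derivation_def pd_add pd_mult)

lemma derivation_dirder: "derivation (dirder r c)"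
  by (simp add: derivation_def dirder_def pd_add pd_mult algebra_simps sum.distrib sum_distrib_left sum_distrib_right)

section \<open>Factorials of exponents and the apolarity pairing\<close>

definition mfact :: "('v \<Rightarrow>\<^sub>0 nat) \<Rightarrow> 'a::comm_semiring_1" where
  "mfact \<alpha> = (\<Prod>i\<in>keys \<alpha>. of_nat (fact (lookup \<alpha> i)))"

lemma mfact_expo: "mfact (expo i + \<alpha>) = of_nat (Suc (lookup \<alpha> i)) * (mfact \<alpha> :: 'a::comm_semiring_1)"
proof -
  let ?S = "insert i (keys \<alpha>)"
  have 1: "mfact \<beta> = (\<Prod>j\<in>?S. of_nat (fact (lookup \<beta> j)) :: 'a)" if "keys \<beta> \<subseteq> ?S" for \<beta>
    unfolding mfact_def by (rule prod.mono_neutral_left) (use that in \<open>auto simp: in_keys_iff\<close>)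
  have "keys (expo i + \<alpha>) \<subseteq> ?S"
    using Poly_Mapping.keys_add[of "expo i" \<alpha>] by auto
  then have "mfact (expo i + \<alpha>) = (\<Prod>j\<in>?S. of_nat (fact (lookup (expo i + \<alpha>) j)) :: 'a)"
    by (rule 1)
  also have "\<dots> = of_nat (Suc (lookup \<alpha> i)) * (\<Prod>j\<in>?S. of_nat (fact (lookup \<alpha> j)))"
  proof -
    have "(\<Prod>j\<in>?S - {i}. of_nat (fact (lookup (expo i + \<alpha>) j)) :: 'a) = (\<Prod>j\<in>?S - {i}. of_nat (fact (lookup \<alpha> j)))"
      by (rule prod.cong) (auto simp: lookup_add lookup_single)
    moreover have "of_nat (fact (lookup (expo i + \<alpha>) i)) = of_nat (Suc (lookup \<alpha> i)) * (of_nat (fact (lookup \<alpha> i)) :: 'a)"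
      by (simp add: lookup_add algebra_simps)
    ultimately show ?thesis
      by (simp add: prod.remove[of ?S i] mult.assoc del: of_nat_Suc)
  qed
  also have "(\<Prod>j\<in>?S. of_nat (fact (lookup \<alpha> j)) :: 'a) = mfact \<alpha>"
    using 1[of \<alpha>, OF subset_insertI] by simp
  finally show ?thesis .
qed

lemma mfact_neq_0: "mfact \<alpha> \<noteq> (0 :: 'a::field_char_0)"
  by (auto simp: mfact_def)

text \<open>The value at \<open>p\<close> of the functional with inverse system \<open>F\<close>: the constant term of $p(\partial) F$.\<close>

definition pairing :: "('v, 'a::comm_ring_1) mpoly \<Rightarrow> ('v, 'a) mpoly \<Rightarrow> 'a" where
  "pairing F p = (\<Sum>\<alpha>\<in>keys p. lookup p \<alpha> * (mfact \<alpha> * lookup F \<alpha>))"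

lemma pairing_superset: "finite S \<Longrightarrow> keys p \<subseteq> S \<Longrightarrow> pairing F p = (\<Sum>\<alpha>\<in>S. lookup p \<alpha> * (mfact \<alpha> * lookup F \<alpha>))"
  unfolding pairing_def by (rule sum.mono_neutral_left) (auto simp: in_keys_iff)

lemma pairing_add: "pairing F (p + q) = pairing F p + pairing F q"
  using Poly_Mapping.keys_add[of p q]
  by (simp add: pairing_superset[of "keys p \<union> keys q"] lookup_add distrib_right sum.distrib)

lemma pairing_0 [simp]: "pairing F 0 = 0"
  and pairing_0_left [simp]: "pairing 0 p = 0"
  by (simp_all add: pairing_def)

lemma pairing_uminus: "pairing F (- p) = - pairing F p"
  using pairing_add[of F p "- p"] by (simp add: eq_neg_iff_add_eq_0 add.commute)

lemma pairing_single: "pairing F (single \<alpha> c) = c * (mfact \<alpha> * lookup F \<alpha>)"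
  by (simp add: pairing_superset[of "{\<alpha>}"])

lemma pairing_add_left: "pairing (F + G) p = pairing F p + pairing G p"
  by (simp add: pairing_def lookup_add distrib_left sum.distrib)

lemma pairing_const_left: "pairing (const c * F) p = c * pairing F p"
  by (simp add: pairing_def sum_distrib_left mult.left_commute)

lemma pairing_const: "pairing F (const c * p) = c * pairing F p"
  by (subst pairing_superset[of "keys p"]) (auto simp: in_keys_iff pairing_def sum_distrib_left mult.assoc)

lemma pairing_sum_left: "pairing (sum f A) p = (\<Sum>a\<in>A. pairing (f a) p)"
  by (induction A rule: infinite_finite_induct) (auto simp: pairing_add_left)

lemma pairing_sum: "pairing F (sum f A) = (\<Sum>a\<in>A. pairing F (f a))"
  by (induction A rule: infinite_finite_induct) (auto simp: pairing_add)

text \<open>The factor \<open>mfact\<close> in the pairing is there for this: adding e_i to the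
  exponent multiplies the factorial by exactly the coefficient that differentiation produces, so
  multiplication by a variable is adjoint to differentiation.\<close>

lemma pairing_var_mult: "pairing F (var i * p) = pairing (pd i F) p"
proof (induction p rule: poly_mapping_additive_induct)
  case (add p q)
  then show ?case by (simp add: distrib_left pairing_add)
next
  case (single \<alpha> c)
  show ?case
    by (simp add: var_mult_single pairing_single mfact_expo lookup_pd add.commute[of \<alpha>] mult_ac del: of_nat_Suc)
qed simp

lemma pairing_linform_mult: "pairing F (linform r c * p) = pairing (dirder r c F) p"
  by (simp add: linform_def dirder_def sum_distrib_right pairing_sum pairing_sum_left mult.assoc
      pairing_const pairing_const_left pairing_var_mult)

lemma pairing_var_power_mult: "pairing F (var i ^ n * p) = pairing ((pd i ^^ n) F) p"
  by (induction n arbitrary: F) (simp_all add: mult.assoc pairing_var_mult funpow_swap1)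

lemma pairing_linform_power_mult: "pairing F (linform r c ^ n * p) = pairing ((dirder r c ^^ n) F) p"
  by (induction n arbitrary: F) (simp_all add: mult.assoc pairing_linform_mult funpow_swap1)

section \<open>Coefficients of the secant hypersurface\<close>

text \<open>With n = card N, the sum is the coefficient of x^(n-1) in the Lagrange interpolant of
  \<open>P\<close> at the nodes; that interpolant is \<open>P\<close> itself, whose degree is below
  n - 1.\<close>

lemma sum_lagrange_eq_0:
  fixes s :: "'i \<Rightarrow> 'b::field" and P :: "'b poly"
  assumes N: "finite N" "inj_on s N" and deg: "Suc (Polynomial.degree P) < card N"
  shows "(\<Sum>i\<in>N. poly P (s i) / (\<Prod>j\<in>N-{i}. s i - s j)) = 0"
proof -
  define T where "T i = (\<Prod>j\<in>N-{i}. [:- s j, 1:])" for i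
  define \<Delta> where "\<Delta> i = (\<Prod>j\<in>N-{i}. s i - s j)" for i
  define Q where "Q = (\<Sum>i\<in>N. Polynomial.smult (poly P (s i) / \<Delta> i) (T i))"
  have \<Delta>: "\<Delta> i \<noteq> 0" if "i \<in> N" for i
    unfolding \<Delta>_def using N that by (auto simp: inj_on_def)
  have T: "Polynomial.degree (T i) = card N - 1" "Polynomial.coeff (T i) (card N - 1) = 1" if "i \<in> N" for i
  proof -
    show "Polynomial.degree (T i) = card N - 1"
      unfolding T_def using that N by (subst degree_prod_eq_sum_degree) auto
    moreover have "lead_coeff (T i) = 1"
      unfolding T_def by (subst lead_coeff_prod) auto
    ultimately show "Polynomial.coeff (T i) (card N - 1) = 1" by simp
  qed
  have pT: "poly (T i) (s j) = (if i = j then \<Delta> i else 0)" if "i \<in> N" "j \<in> N" for i j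
    using that N by (auto simp: T_def \<Delta>_def poly_prod)
  have "Q = P"
  proof (rule poly_eqI_degree[of "s ` N"])
    fix x assume "x \<in> s ` N"
    then obtain j where j: "j \<in> N" "x = s j" by auto
    have "poly Q x = (\<Sum>i\<in>N. if i = j then poly P (s j) else 0)"
      unfolding Q_def using j \<Delta> by (auto simp: poly_sum pT intro!: sum.cong)
    then show "poly Q x = poly P x" using j N by simp
  next
    have "Polynomial.degree Q \<le> card N - 1"
      unfolding Q_def using T by (intro degree_sum_le) (auto intro: order.trans[OF degree_smult_le] N)
    then show "Polynomial.degree Q < card (s ` N)" using deg N by (simp add: card_image)
  qed (use deg N in \<open>simp add: card_image\<close>)
  then have "Polynomial.coeff Q (card N - 1) = 0" using deg by (simp add: coeff_eq_0)
  then show ?thesis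
    unfolding Q_def using T by (simp add: coeff_sum \<Delta>_def)
qed

text \<open>The coefficient of $\prod_{i \in A} y_i$ in the determinant of the Hankel matrix
  $\bigl(\sum_i y_i w_i s_i^{a+b}\bigr)_{a,b<k}$ with $w_i = s_i / \prod_{j \ne i} (s_i - s_j)$, up to a
  sign that depends on \<open>k\<close> only. This determinant defines a secant variety of the rational normal
  curve through the given points.\<close>

definition hankel_coeff :: "('i \<Rightarrow> 'b::field) \<Rightarrow> 'i set \<Rightarrow> 'i set \<Rightarrow> 'b" where
  "hankel_coeff s U A = (\<Prod>i\<in>A. s i) / (\<Prod>i\<in>A. \<Prod>j\<in>U-A. s i - s j)"

text \<open>Moving \<open>i\<close> from the complement into \<open>A\<close> takes the factors
  \<open>s b - s i\<close> out of the denominator and adds the differences of \<open>s i\<close> to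
  the remaining complement. The correction thus has the shape of a Lagrange term for the nodes in
  \<open>U - A\<close>.\<close>

lemma hankel_coeff_insert:
  assumes U: "finite U" "inj_on s U" and A: "A \<subseteq> U" "i \<in> U" "i \<notin> A"
  shows "hankel_coeff s U (insert i A)
    = hankel_coeff s U A * (s i * (\<Prod>b\<in>A. s b - s i) / (\<Prod>j\<in>U-A-{i}. s i - s j))"
proof -
  have fin: "finite A" using A U finite_subset by auto
  have eq: "U - insert i A = U - A - {i}" "U - A = insert i (U - A - {i})" using A by auto
  have split: "(\<Prod>b\<in>A. \<Prod>j\<in>U-A. s b - s j) = (\<Prod>b\<in>A. s b - s i) * (\<Prod>b\<in>A. \<Prod>j\<in>U-A-{i}. s b - s j)"
    by (subst eq(2), subst prod.insert) (use U in \<open>auto simp: prod.distrib\<close>)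
  have "(\<Prod>b\<in>A. s b - s i) \<noteq> 0" using fin A U by (auto simp: inj_on_def)
  then show ?thesis
    unfolding hankel_coeff_def split eq(1)
    using fin A by (simp add: ac_simps)
qed

lemma hankel_coeff_neq_0:
  assumes "finite U" "inj_on s U" "A \<subseteq> U" "\<And>i. i \<in> U \<Longrightarrow> s i \<noteq> 0"
  shows "hankel_coeff s U A \<noteq> 0"
proof -
  have "finite A" using assms finite_subset by auto
  then show ?thesis
    using assms by (auto simp: hankel_coeff_def inj_on_def)
qed

text \<open>Up to the common factor \<open>hankel_coeff s U B\<close> this is the Lagrange sum of
  \<Prod>_(b \<in> B) (s_b - x), of degree at most \<open>card B\<close>, over the
  \<open>card B + 2\<close> nodes outside \<open>B\<close>. For s_i = 1 / c_i it is the coefficient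
  of y^B in the derivative of G along c.\<close>

lemma hankel_coeff_relation1:
  assumes U: "finite U" "inj_on s U" "\<And>i. i \<in> U \<Longrightarrow> s i \<noteq> 0"
    and B: "B \<subseteq> U" and card: "card U = 2 * Suc (card B)"
  shows "(\<Sum>i\<in>U-B. hankel_coeff s U (insert i B) / s i) = 0"
proof -
  have fin: "finite B" using B U finite_subset by auto
  define P where "P = (\<Prod>b\<in>B. [:s b, -1:])"
  have pP: "poly P x = (\<Prod>b\<in>B. s b - x)" for x by (simp add: P_def poly_prod)
  have "Polynomial.degree P \<le> card B"
    unfolding P_def using degree_prod_sum_le[OF fin, of "\<lambda>b. [:s b, -1:]"] by simp
  moreover have "card (U - B) = card B + 2" using card fin B by (simp add: card_Diff_subset)
  ultimately have "(\<Sum>i\<in>U-B. poly P (s i) / (\<Prod>j\<in>U-B-{i}. s i - s j)) = 0"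
    using U by (intro sum_lagrange_eq_0) (auto intro: inj_on_subset)
  then have "hankel_coeff s U B * (\<Sum>i\<in>U-B. poly P (s i) / (\<Prod>j\<in>U-B-{i}. s i - s j)) = 0" by simp
  then show ?thesis
    unfolding sum_distrib_left
    by (rule trans[OF sum.cong[OF refl], rotated])
      (use U B in \<open>auto simp: hankel_coeff_insert pP\<close>)
qed

text \<open>Up to a common factor the terms are -q_i q_j (s_i - s_j)^2. Expanding the square leaves
  in every product a factor \<Sum> q_i or \<Sum> s_i q_i, and both are Lagrange sums of polynomials
  of too low degree. This is the coefficient of y^C in the second derivative of G along (1, ...,
  1).\<close>

lemma hankel_coeff_relation2:
  assumes U: "finite U" "inj_on s U"
    and C: "C \<subseteq> U" and card: "card U = 2 * Suc (Suc (card C))"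
  shows "(\<Sum>i\<in>U-C. \<Sum>j\<in>U-C-{i}. hankel_coeff s U (insert i (insert j C))) = 0"
proof -
  have fin: "finite C" using C U finite_subset by auto
  define N where "N = U - C"
  define Q where "Q = [:0, 1:] * (\<Prod>b\<in>C. [:s b, -1:])"
  have pQ: "poly Q x = x * (\<Prod>b\<in>C. s b - x)" for x by (simp add: Q_def poly_prod)
  have "Polynomial.degree Q \<le> Suc (card C)"
    unfolding Q_def using degree_prod_sum_le[OF fin, of "\<lambda>b. [:s b, -1:]"]
    by (intro order.trans[OF degree_mult_le]) simp
  have N: "finite N" "inj_on s N" "card N = card C + 4"
    using U fin C card by (auto simp: N_def card_Diff_subset intro: inj_on_subset)
  define q where "q i = poly Q (s i) / (\<Prod>j\<in>N-{i}. s i - s j)" for i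
  have q0: "(\<Sum>i\<in>N. q i) = 0"
    unfolding q_def by (rule sum_lagrange_eq_0) (use N \<open>Polynomial.degree Q \<le> _\<close> in auto)
  have "Polynomial.degree ([:0, 1:] * Q) \<le> Suc (Suc (card C))"
    by (intro order.trans[OF degree_mult_le]) (use \<open>Polynomial.degree Q \<le> _\<close> in simp)
  then have "(\<Sum>i\<in>N. poly ([:0, 1:] * Q) (s i) / (\<Prod>j\<in>N-{i}. s i - s j)) = 0"
    by (intro sum_lagrange_eq_0) (use N in auto)
  then have q1: "(\<Sum>i\<in>N. s i * q i) = 0" by (simp add: q_def)
  have eq: "hankel_coeff s U (insert i (insert j C)) = hankel_coeff s U C * - (q i * q j * (s i - s j)^2)"
    if "i \<in> N" "j \<in> N - {i}" for i j
  proof -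
    have ij: "i \<in> U" "i \<notin> C" "j \<in> U" "j \<notin> C" "i \<noteq> j" using that by (auto simp: N_def)
    have sij: "s i - s j \<noteq> 0" using ij U by (auto simp: inj_on_def)
    have 1: "hankel_coeff s U (insert j C) = hankel_coeff s U C * q j"
      unfolding q_def pQ using hankel_coeff_insert[OF U C, of j] ij by (simp add: N_def)
    define R where "R = (\<Prod>l\<in>N-{i}-{j}. s i - s l)"
    have R: "(\<Prod>l\<in>N-{i}. s i - s l) = (s i - s j) * R"
      unfolding R_def by (rule prod.remove) (use that N in auto)
    have "U - insert j C - {i} = N - {i} - {j}" by (auto simp: N_def)
    then have "s i * (\<Prod>b\<in>insert j C. s b - s i) / (\<Prod>l\<in>U - insert j C - {i}. s i - s l)
        = s i * ((s j - s i) * (\<Prod>b\<in>C. s b - s i)) / R"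
      using fin ij by (simp add: R_def)
    also have "\<dots> = - (s i * (\<Prod>b\<in>C. s b - s i) * (s i - s j) / R)"
      by (simp add: algebra_simps diff_divide_distrib)
    also have "\<dots> = - (q i * (s i - s j)^2)"
      unfolding q_def pQ R using sij by (simp add: power2_eq_square)
    finally have 2: "s i * (\<Prod>b\<in>insert j C. s b - s i) / (\<Prod>l\<in>U - insert j C - {i}. s i - s l)
        = - (q i * (s i - s j)^2)" .
    show ?thesis
      using hankel_coeff_insert[OF U, of "insert j C" i] ij C unfolding 1 2 by simp
  qed
  have "(\<Sum>i\<in>N. \<Sum>j\<in>N-{i}. hankel_coeff s U (insert i (insert j C)))
      = (\<Sum>i\<in>N. \<Sum>j\<in>N-{i}. hankel_coeff s U C * - (q i * q j * (s i - s j)^2))"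
    by (intro sum.cong refl eq)
  \<comment> \<open>The diagonal may be included, since its terms contain (s_i - s_i)^2.\<close>
  also have "\<dots> = (\<Sum>i\<in>N. \<Sum>j\<in>N. hankel_coeff s U C * - (q i * q j * (s i - s j)^2))"
    by (intro sum.cong refl sum.mono_neutral_left) (use N in auto)
  also have "\<dots> = hankel_coeff s U C * - (\<Sum>i\<in>N. \<Sum>j\<in>N. q i * q j * (s i - s j)^2)"
    by (simp add: sum_distrib_left sum_negf)
  also have "(\<Sum>i\<in>N. \<Sum>j\<in>N. q i * q j * (s i - s j)^2)
      = (\<Sum>i\<in>N. (s i)^2 * q i) * (\<Sum>j\<in>N. q j) - 2 * ((\<Sum>i\<in>N. s i * q i) * (\<Sum>j\<in>N. s j * q j))
        + (\<Sum>i\<in>N. q i) * (\<Sum>j\<in>N. (s j)^2 * q j)"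
    unfolding sum_product unfolding sum_distrib_left sum_subtractf[symmetric] sum.distrib[symmetric]
    by (intro sum.cong refl) (simp add: power2_eq_square algebra_simps)
  also have "\<dots> = 0" by (simp add: q0 q1)
  finally show ?thesis by (simp add: N_def)
qed

text \<open>For distinct nonzero \<open>c i\<close> one may take \<open>hankel_coeff\<close> with \<open>s i = 1 / c i\<close>. In general \<open>c\<close> is
  deformed over the field of Laurent series, and the lowest coefficients that occur survive.\<close>

lemma ex_hankel_relations:
  fixes c :: "nat \<Rightarrow> 'a::field_char_0"
  shows "\<exists>g :: nat set \<Rightarrow> 'a.
    (\<exists>A\<subseteq>{..<2*k}. card A = k \<and> g A \<noteq> 0) \<and>
    (\<forall>B\<subseteq>{..<2*k}. Suc (card B) = k \<longrightarrow> (\<Sum>i\<in>{..<2*k}-B. c i * g (insert i B)) = 0) \<and>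
    (\<forall>C\<subseteq>{..<2*k}. Suc (Suc (card C)) = k \<longrightarrow>
      (\<Sum>i\<in>{..<2*k}-C. \<Sum>j\<in>{..<2*k}-C-{i}. g (insert i (insert j C))) = 0)"
proof -
  define U where "U = {..<2*k}"
  \<comment> \<open>The coefficient of X is i + 1, so in characteristic 0 the deformed values are
    pairwise distinct and nonzero, whatever \<open>c\<close> is.\<close>
  define c' where "c' i = fls_const (c i) + fls_X * fls_const (of_nat (Suc i))" for i
  define s where "s i = inverse (c' i)" for i
  define h where "h = hankel_coeff s U"
  define \<A> where "\<A> = {A. A \<subseteq> U \<and> card A = k}"
  have nth_c': "fls_nth (c' i) 1 = of_nat (Suc i)" for i
    by (simp add: c'_def fls_X_times_conv_shift)
  have "finite U" by (simp add: U_def)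
  have inj: "inj_on s U"
  proof (rule inj_onI)
    fix i j assume "s i = s j"
    then have "c' i = c' j" by (simp add: s_def)
    then have "(of_nat (Suc i) :: 'a) = of_nat (Suc j)" by (metis nth_c')
    then show "i = j" by (simp only: of_nat_eq_iff)
  qed
  have c'0: "c' i \<noteq> 0" for i
  proof
    assume "c' i = 0"
    then have "(of_nat (Suc i) :: 'a) = 0" using nth_c'[of i] by simp
    then show False by (simp del: of_nat_Suc)
  qed
  have "finite \<A>" unfolding \<A>_def U_def by (rule finite_subset[of _ "Pow {..<2*k}"]) auto
  moreover have "{..<k} \<in> \<A>" by (auto simp: \<A>_def U_def)
  ultimately obtain A0 where A0: "A0 \<in> \<A>" "\<And>A. A \<in> \<A> \<Longrightarrow> fls_subdegree (h A0) \<le> fls_subdegree (h A)"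
    using ex_is_arg_min_if_finite[of \<A> "\<lambda>A. fls_subdegree (h A)"] by (auto simp: is_arg_min_linorder)
  \<comment> \<open>The least order that occurs among all coefficients: taking every coefficient at
    \<nu> is the limit X -> 0 after division by X^\<nu>, and it is nonzero at
    \<open>A0\<close>.\<close>
  define \<nu> where "\<nu> = fls_subdegree (h A0)"
  define g where "g A = fls_nth (h A) \<nu>" for A
  have low: "fls_nth (h A) (\<nu> - 1) = 0" if "A \<in> \<A>" for A
    using A0(2)[OF that] by (intro fls_eq0_below_subdegree) (simp add: \<nu>_def)
  have "h A0 \<noteq> 0"
    unfolding h_def by (rule hankel_coeff_neq_0) (use A0 inj c'0 \<open>finite U\<close> in \<open>auto simp: \<A>_def s_def\<close>)
  then have "g A0 \<noteq> 0" by (simp add: g_def \<nu>_def)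
  moreover have "(\<Sum>i\<in>U-B. c i * g (insert i B)) = 0" if B: "B \<subseteq> U" "Suc (card B) = k" for B
  proof -
    have "finite B" using B \<open>finite U\<close> finite_subset by auto
    then have mem: "insert i B \<in> \<A>" if "i \<in> U - B" for i using that B by (auto simp: \<A>_def)
    have "(\<Sum>i\<in>U-B. h (insert i B) / s i) = 0"
      unfolding h_def
      by (rule hankel_coeff_relation1) (use inj c'0 B \<open>finite U\<close> in \<open>auto simp: s_def U_def\<close>)
    then have "fls_nth (\<Sum>i\<in>U-B. c' i * h (insert i B)) \<nu> = 0"
      by (simp add: s_def divide_inverse mult.commute)
    also have "fls_nth (\<Sum>i\<in>U-B. c' i * h (insert i B)) \<nu> = (\<Sum>i\<in>U-B. fls_nth (c' i * h (insert i B)) \<nu>)"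
      by (rule fls_nth_sum)
    \<comment> \<open>The deformation term carries a factor X and so reads \<open>h\<close> at \<nu>
      - 1, where it vanishes by minimality; only \<open>c i\<close> remains.\<close>
    also have "\<dots> = (\<Sum>i\<in>U-B. c i * g (insert i B))"
    proof (rule sum.cong[OF refl])
      fix i assume "i \<in> U - B"
      then have "fls_nth (fls_const (of_nat (Suc i)) * h (insert i B)) (\<nu> - 1) = 0"
        using low[OF mem] by simp
      then show "fls_nth (c' i * h (insert i B)) \<nu> = c i * g (insert i B)"
        unfolding c'_def g_def distrib_right mult.assoc by (simp add: fls_X_times_conv_shift del: of_nat_Suc fls_const_nonzero)
    qed
    finally show ?thesis .
  qed
  moreover have "(\<Sum>i\<in>U-C. \<Sum>j\<in>U-C-{i}. g (insert i (insert j C))) = 0"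
    if C: "C \<subseteq> U" "Suc (Suc (card C)) = k" for C
  proof -
    have "(\<Sum>i\<in>U-C. \<Sum>j\<in>U-C-{i}. h (insert i (insert j C))) = 0"
      unfolding h_def by (rule hankel_coeff_relation2) (use inj C \<open>finite U\<close> in \<open>auto simp: U_def\<close>)
    then have "fls_nth (\<Sum>i\<in>U-C. \<Sum>j\<in>U-C-{i}. h (insert i (insert j C))) \<nu> = 0" by simp
    then show ?thesis by (simp add: fls_nth_sum g_def)
  qed
  ultimately show ?thesis using A0(1) unfolding U_def \<A>_def by blast
qed

section \<open>The inverse system\<close>

lemma mdegree_superset: "finite S \<Longrightarrow> keys m \<subseteq> S \<Longrightarrow> mdegree m = (\<Sum>v\<in>S. lookup m v)"
  unfolding mdegree_def by (rule sum.mono_neutral_left) (auto simp: in_keys_iff)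

lemma mdegree_add: "mdegree (m + n) = mdegree m + mdegree n"
  using Poly_Mapping.keys_add[of m n]
  by (simp add: mdegree_superset[of "keys m \<union> keys n"] lookup_add sum.distrib)

lemma mdegree_0 [simp]: "mdegree 0 = 0"
  and mdegree_expo [simp]: "mdegree (expo i) = 1"
  by (simp_all add: mdegree_def)

lemma mem_homogeneous_part:
  "p \<in> homogeneous_part r d \<longleftrightarrow> (\<forall>m\<in>keys p. keys m \<subseteq> {..<r} \<and> mdegree m = d)"
  by (auto simp: homogeneous_part_def poly_ring_def indets_def)

lemma homogeneous_part_0: "0 \<in> homogeneous_part r d"
  by (simp add: mem_homogeneous_part)

lemma homogeneous_part_1: "1 \<in> homogeneous_part r 0"
  by (simp add: mem_homogeneous_part)

lemma homogeneous_part_add: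
  "p \<in> homogeneous_part r d \<Longrightarrow> q \<in> homogeneous_part r d \<Longrightarrow> p + q \<in> homogeneous_part r d"
  using Poly_Mapping.keys_add[of p q] by (auto simp: mem_homogeneous_part)

lemma homogeneous_part_uminus: "p \<in> homogeneous_part r d \<Longrightarrow> - p \<in> homogeneous_part r d"
  by (simp add: mem_homogeneous_part)

lemma homogeneous_part_diff:
  "p \<in> homogeneous_part r d \<Longrightarrow> q \<in> homogeneous_part r d \<Longrightarrow> p - q \<in> homogeneous_part r d"
  using homogeneous_part_add[of p r d "- q"] homogeneous_part_uminus[of q r d] by simp

lemma homogeneous_part_mult:
  assumes "p \<in> homogeneous_part r d" "q \<in> homogeneous_part r e"
  shows "p * q \<in> homogeneous_part r (d + e)"
  unfolding mem_homogeneous_part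
proof
  fix m assume "m \<in> keys (p * q)"
  then obtain a b where "m = a + b" "a \<in> keys p" "b \<in> keys q" using keys_mult[of p q] by blast
  with assms have "keys a \<subseteq> {..<r}" "keys b \<subseteq> {..<r}" "mdegree m = d + e"
    by (auto simp: mem_homogeneous_part mdegree_add)
  with \<open>m = a + b\<close> show "keys m \<subseteq> {..<r} \<and> mdegree m = d + e"
    using Poly_Mapping.keys_add[of a b] by blast
qed

lemma homogeneous_part_power: "p \<in> homogeneous_part r d \<Longrightarrow> p ^ n \<in> homogeneous_part r (n * d)"
  by (induction n) (simp_all add: homogeneous_part_1 homogeneous_part_mult)

lemma homogeneous_part_const_mult: "p \<in> homogeneous_part r d \<Longrightarrow> const a * p \<in> homogeneous_part r d"
  by (auto simp: mem_homogeneous_part in_keys_iff)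

lemma homogeneous_part_sum: "(\<And>i. i \<in> A \<Longrightarrow> f i \<in> homogeneous_part r d) \<Longrightarrow> sum f A \<in> homogeneous_part r d"
  by (induction A rule: infinite_finite_induct) (auto intro: homogeneous_part_0 homogeneous_part_add)

lemma var_homogeneous: "i < r \<Longrightarrow> var i \<in> homogeneous_part r 1"
  by (auto simp: mem_homogeneous_part var_def)

lemma linform_homogeneous: "linform r c \<in> homogeneous_part r 1"
  unfolding linform_def by (intro homogeneous_part_sum homogeneous_part_const_mult var_homogeneous) auto

lemma mdegree_1_iff: "mdegree m = 1 \<longleftrightarrow> (\<exists>i. m = expo i)"
proof
  assume m: "mdegree m = 1"
  then have "keys m \<noteq> {}" by (auto simp: mdegree_def)
  then obtain i where "i \<in> keys m" by blast
  then have e: "m = expo i + (m - expo i)" by (simp add: expo_add_diff in_keys_iff)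
  have "mdegree m = 1 + mdegree (m - expo i)" by (subst e) (simp add: mdegree_add)
  with m have "\<forall>v\<in>keys (m - expo i). lookup (m - expo i) v = 0" by (simp add: mdegree_def)
  then have "\<forall>v. lookup (m - expo i) v = 0" by (auto simp: in_keys_iff simp del: lookup_minus)
  then have "m - expo i = 0" by (intro poly_mapping_eqI) simp
  then show "\<exists>i. m = expo i" using e by auto
qed auto

lemma homogeneous_part_1_linform:
  assumes "f \<in> homogeneous_part r 1"
  shows "f = linform r (\<lambda>i. lookup f (expo i))"
proof (rule poly_mapping_eqI)
  fix m :: "nat \<Rightarrow>\<^sub>0 nat"
  have var: "lookup (var i) m = (if m = expo i then 1 else 0)" for i
    by (auto simp: var_def lookup_single when_def)
  have eq: "lookup (linform r (\<lambda>i. lookup f (expo i))) m = (\<Sum>i<r. lookup f (expo i) * (if m = expo i then 1 else 0))"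
    by (simp add: linform_def lookup_sum var)
  show "lookup f m = lookup (linform r (\<lambda>i. lookup f (expo i))) m"
  proof (cases "\<exists>j<r. m = expo j")
    case True
    then obtain j where j: "j < r" "m = expo j" by auto
    have inj: "expo j = expo i \<longleftrightarrow> i = j" for i by (metis lookup_single_eq lookup_single_not_eq nat.distinct(1))
    show ?thesis unfolding eq using j by (simp add: inj sum.delta if_distrib cong: if_cong)
  next
    case False
    have "m \<notin> keys f"
    proof
      assume "m \<in> keys f"
      with assms have "keys m \<subseteq> {..<r}" "mdegree m = 1" by (auto simp: mem_homogeneous_part)
      then obtain j where "m = expo j" by (auto simp only: mdegree_1_iff)
      with \<open>keys m \<subseteq> {..<r}\<close> show False using False by auto
    qed
    moreover have "(\<Sum>i<r. lookup f (expo i) * (if m = expo i then 1 else 0)) = 0"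
      using False by (intro sum.neutral) auto
    ultimately show ?thesis unfolding eq by (simp add: in_keys_iff)
  qed
qed

section \<open>Squarefree monomials and the secant equation\<close>

definition sqfree :: "'v set \<Rightarrow> 'v \<Rightarrow>\<^sub>0 nat" where
  "sqfree A = (\<Sum>i\<in>A. expo i)"

lemma lookup_sqfree: "finite A \<Longrightarrow> lookup (sqfree A) i = (if i \<in> A then 1 else 0)"
  by (simp add: sqfree_def lookup_sum lookup_single when_def sum.delta)

lemma sqfree_insert: "finite A \<Longrightarrow> i \<notin> A \<Longrightarrow> sqfree A + expo i = sqfree (insert i A)"
  by (simp add: sqfree_def add.commute)

lemma keys_sqfree: "finite A \<Longrightarrow> keys (sqfree A) = A"
  by (auto simp: in_keys_iff lookup_sqfree split: if_splits)

lemma sqfree_eq_iff: "finite A \<Longrightarrow> finite B \<Longrightarrow> sqfree A = sqfree B \<longleftrightarrow> A = B"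
  by (metis keys_sqfree)

lemma mdegree_sqfree: "finite A \<Longrightarrow> mdegree (sqfree A) = card A"
  by (simp add: mdegree_def keys_sqfree lookup_sqfree)

lemma sqfree_eq_add_expo:
  assumes "finite A" "\<beta> + expo i = sqfree A"
  shows "i \<in> A" "\<beta> = sqfree (A - {i})"
proof -
  have "lookup (sqfree A) i = Suc (lookup \<beta> i)" unfolding assms(2)[symmetric] by (simp add: lookup_add)
  then show i: "i \<in> A" using assms(1) by (simp add: lookup_sqfree split: if_splits)
  have "\<beta> + expo i = sqfree (A - {i}) + expo i"
    using assms i by (simp add: sqfree_insert insert_absorb)
  then show "\<beta> = sqfree (A - {i})" by simp
qed

text \<open>The squarefree polynomial with coefficients \<open>g\<close>: the two families of
  relations are the coefficients of its derivative along c and of its second derivative along (1,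
  ..., 1), and squarefreeness kills every pure second partial derivative.\<close>

lemma ex_multilinear_form:
  fixes c :: "nat \<Rightarrow> 'a::field_char_0" and k r :: nat
  defines "r \<equiv> 2 * k"
  shows "\<exists>G. G \<noteq> 0 \<and> G \<in> homogeneous_part r k \<and> dirder r c G = 0 \<and>
    dirder r (\<lambda>_. 1) (dirder r (\<lambda>_. 1) G) = 0 \<and> (\<forall>i. pd i (pd i G) = 0)"
proof -
  obtain g :: "nat set \<Rightarrow> 'a" where
    g: "\<exists>A\<subseteq>{..<r}. card A = k \<and> g A \<noteq> 0"
    and rel1: "\<And>B. B \<subseteq> {..<r} \<Longrightarrow> Suc (card B) = k \<Longrightarrow> (\<Sum>i\<in>{..<r}-B. c i * g (insert i B)) = 0"
    and rel2: "\<And>C. C \<subseteq> {..<r} \<Longrightarrow> Suc (Suc (card C)) = k \<Longrightarrow>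
      (\<Sum>i\<in>{..<r}-C. \<Sum>j\<in>{..<r}-C-{i}. g (insert i (insert j C))) = 0"
    using ex_hankel_relations[of k c] unfolding r_def by blast
  define \<A> where "\<A> = {A. A \<subseteq> {..<r} \<and> card A = k}"
  have fin\<A>: "finite \<A>" unfolding \<A>_def by (rule finite_subset[of _ "Pow {..<r}"]) auto
  have fin: "finite A" if "A \<subseteq> {..<r}" for A using that finite_subset by auto
  then have finA: "finite A" if "A \<in> \<A>" for A using that by (auto simp: \<A>_def)
  define G where "G = (\<Sum>A\<in>\<A>. single (sqfree A) (g A))"
  have G: "lookup G (sqfree A) = (if A \<in> \<A> then g A else 0)" if "finite A" for A
  proof -
    have "lookup G (sqfree A) = (\<Sum>B\<in>\<A>. if B = A then g B else 0)"
      unfolding G_def lookup_sum lookup_single when_def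
      by (intro sum.cong refl) (use finA that in \<open>auto simp: sqfree_eq_iff\<close>)
    then show ?thesis using fin\<A> by simp
  qed
  have G0: "\<exists>A\<in>\<A>. \<beta> = sqfree A" if "lookup G \<beta> \<noteq> 0" for \<beta>
  proof -
    have "\<exists>A\<in>\<A>. lookup (single (sqfree A) (g A)) \<beta> \<noteq> 0"
      using that unfolding G_def lookup_sum by (metis (no_types, lifting) sum.neutral)
    then show ?thesis by (auto simp: lookup_single when_def split: if_splits)
  qed
  have G1: "\<exists>A\<in>\<A>. i \<in> A \<and> \<beta> = sqfree (A - {i})" if "lookup G (\<beta> + expo i) \<noteq> 0" for \<beta> i
    using G0[OF that] sqfree_eq_add_expo[of _ \<beta> i] finA by metis
  have G2: "\<exists>A\<in>\<A>. i \<in> A \<and> j \<in> A \<and> i \<noteq> j \<and> \<beta> = sqfree (A - {j} - {i})"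
    if nz: "lookup G (\<beta> + expo i + expo j) \<noteq> 0" for \<beta> i j
  proof -
    obtain A where A: "A \<in> \<A>" "j \<in> A" "\<beta> + expo i = sqfree (A - {j})" using G1[OF nz] by auto
    then have "i \<in> A - {j}" "\<beta> = sqfree (A - {j} - {i})"
      using sqfree_eq_add_expo[of "A - {j}" \<beta> i] finA[of A] by auto
    with A show ?thesis by blast
  qed
  obtain A0 where A0: "A0 \<in> \<A>" "g A0 \<noteq> 0" using g by (auto simp: \<A>_def)
  then have "lookup G (sqfree A0) \<noteq> 0" using G finA by simp
  then have "G \<noteq> 0" by auto
  moreover have "G \<in> homogeneous_part r k"
    unfolding mem_homogeneous_part
  proof
    fix m assume "m \<in> keys G"
    then obtain A where "A \<in> \<A>" "m = sqfree A" using G0[of m] by (auto simp: in_keys_iff)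
    then show "keys m \<subseteq> {..<r} \<and> mdegree m = k"
      using finA[of A] by (auto simp: keys_sqfree mdegree_sqfree \<A>_def)
  qed
  moreover have "dirder r c G = 0"
  proof (rule poly_mapping_eqI)
    fix \<beta>
    have eq: "lookup (dirder r c G) \<beta> = (\<Sum>i<r. c i * (of_nat (Suc (lookup \<beta> i)) * lookup G (\<beta> + expo i)))"
      by (simp add: dirder_def lookup_sum lookup_pd del: of_nat_Suc)
    have "\<dots> = 0"
    proof (cases "\<exists>i<r. lookup G (\<beta> + expo i) \<noteq> 0")
      case True
      \<comment> \<open>One nonzero term forces \<beta> to be a squarefree monomial in k - 1
        variables, with support B; the whole sum is then the relation \<open>rel1\<close> for
        B.\<close>
      then obtain i A where A: "A \<in> \<A>" "i \<in> A" "\<beta> = sqfree (A - {i})" using G1 by blast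
      define B where "B = A - {i}"
      have B: "B \<subseteq> {..<r}" "Suc (card B) = k"
        using A(1,2) card_Suc_Diff1[OF finA[OF A(1)] A(2)] by (auto simp: B_def \<A>_def)
      have \<beta>: "\<beta> = sqfree B" using A by (simp add: B_def)
      have "(\<Sum>i<r. c i * (of_nat (Suc (lookup \<beta> i)) * lookup G (\<beta> + expo i)))
          = (\<Sum>i\<in>{..<r}-B. c i * (of_nat (Suc (lookup \<beta> i)) * lookup G (\<beta> + expo i)))"
      proof (rule sum.mono_neutral_right)
        show "\<forall>i\<in>{..<r}-({..<r}-B). c i * (of_nat (Suc (lookup \<beta> i)) * lookup G (\<beta> + expo i)) = 0"
        proof
          fix i assume "i \<in> {..<r}-({..<r}-B)"
          then have i: "i \<in> B" by simp
          have "lookup G (\<beta> + expo i) = 0"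
          proof (rule ccontr)
            assume "lookup G (\<beta> + expo i) \<noteq> 0"
            then obtain A' where "A' \<in> \<A>" "\<beta> = sqfree (A' - {i})" using G1 by blast
            then have "B = A' - {i}" using \<beta> sqfree_eq_iff[of B "A' - {i}"] fin[OF B(1)] finA[of A'] by simp
            then show False using i by simp
          qed
          then show "c i * (of_nat (Suc (lookup \<beta> i)) * lookup G (\<beta> + expo i)) = 0" by simp
        qed
      qed auto
      also have "\<dots> = (\<Sum>i\<in>{..<r}-B. c i * g (insert i B))"
      proof (rule sum.cong[OF refl])
        fix i assume i: "i \<in> {..<r}-B"
        then have "insert i B \<in> \<A>" using B fin[OF B(1)] by (simp add: \<A>_def)
        then show "c i * (of_nat (Suc (lookup \<beta> i)) * lookup G (\<beta> + expo i)) = c i * g (insert i B)"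
          using i fin[OF B(1)] by (simp add: \<beta> sqfree_insert G lookup_sqfree)
      qed
      also have "\<dots> = 0" by (rule rel1) (use B in auto)
      finally show ?thesis .
    qed (auto intro!: sum.neutral)
    then show "lookup (dirder r c G) \<beta> = lookup 0 \<beta>" unfolding eq by simp
  qed
  moreover have "dirder r (\<lambda>_. 1) (dirder r (\<lambda>_. 1) G) = 0"
  proof (rule poly_mapping_eqI)
    fix \<beta>
    define T where "T i j = of_nat (Suc (lookup \<beta> i)) * (of_nat (Suc (lookup (\<beta> + expo i) j)) * lookup G (\<beta> + expo i + expo j))" for i j
    have eq: "lookup (dirder r (\<lambda>_. 1) (dirder r (\<lambda>_. 1) G)) \<beta> = (\<Sum>i<r. \<Sum>j<r. T i j)"
      by (simp add: dirder_def lookup_sum lookup_pd sum_distrib_left T_def del: of_nat_Suc)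
    have "\<dots> = 0"
    proof (cases "\<exists>i j. lookup G (\<beta> + expo i + expo j) \<noteq> 0")
      case True
      then obtain i j A where A: "A \<in> \<A>" "i \<in> A" "j \<in> A" "i \<noteq> j" "\<beta> = sqfree (A - {j} - {i})" using G2 by blast
      define C where "C = A - {j} - {i}"
      have "A = insert i (insert j C)" "i \<notin> insert j C" "j \<notin> C" using A by (auto simp: C_def)
      then have C: "C \<subseteq> {..<r}" "Suc (Suc (card C)) = k"
        using A(1) finA[OF A(1)] by (auto simp: \<A>_def)
      have \<beta>: "\<beta> = sqfree C" using A by (simp add: C_def)
      \<comment> \<open>If \<open>i\<close> or \<open>j\<close> lay in \<open>C\<close>, or if they
        were equal, the monomial would contain a square and be absent from \<open>G\<close>.\<close>
      have T0: "T i j = 0" if "\<not> (i \<in> {..<r} - C \<and> j \<in> {..<r}-C-{i})" for i j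
      proof (rule ccontr)
        assume "T i j \<noteq> 0"
        then have "lookup G (\<beta> + expo i + expo j) \<noteq> 0" by (auto simp: T_def)
        then obtain A' where A': "A' \<in> \<A>" "i \<in> A'" "j \<in> A'" "i \<noteq> j" "\<beta> = sqfree (A' - {j} - {i})" using G2 by blast
        then have "C = A' - {j} - {i}"
          using \<beta> sqfree_eq_iff[of C "A' - {j} - {i}"] fin[OF C(1)] finA[of A'] by simp
        then show False using A' that by (auto simp: \<A>_def)
      qed
      have "(\<Sum>i<r. \<Sum>j<r. T i j) = (\<Sum>i\<in>{..<r}-C. \<Sum>j<r. T i j)"
        by (rule sum.mono_neutral_right) (auto intro!: sum.neutral T0)
      also have "\<dots> = (\<Sum>i\<in>{..<r}-C. \<Sum>j\<in>{..<r}-C-{i}. T i j)"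
        by (intro sum.cong refl sum.mono_neutral_right) (auto intro!: T0)
      also have "\<dots> = (\<Sum>i\<in>{..<r}-C. \<Sum>j\<in>{..<r}-C-{i}. g (insert i (insert j C)))"
      proof (intro sum.cong refl)
        fix i j assume i: "i \<in> {..<r}-C" and j: "j \<in> {..<r}-C-{i}"
        have "insert j (insert i C) \<in> \<A>" using i j C fin[OF C(1)] by (auto simp: \<A>_def)
        then show "T i j = g (insert i (insert j C))"
          using i j fin[OF C(1)] by (simp add: T_def \<beta> sqfree_insert G lookup_sqfree insert_commute)
      qed
      also have "\<dots> = 0" by (rule rel2) (use C in auto)
      finally show ?thesis .
    qed (auto simp: T_def intro!: sum.neutral)
    then show "lookup (dirder r (\<lambda>_. 1) (dirder r (\<lambda>_. 1) G)) \<beta> = lookup 0 \<beta>" unfolding eq by simp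
  qed
  moreover have "pd i (pd i G) = 0" for i
    by (rule poly_mapping_eqI) (use G2[of _ i i] in \<open>auto simp: lookup_pd\<close>)
  ultimately show ?thesis by blast
qed

text \<open>The inverse system is the $m$-th power of the multilinear form.\<close>

lemma ex_inverse_system:
  fixes c :: "nat \<Rightarrow> 'a::field_char_0" and k r :: nat
  defines "r \<equiv> 2 * k"
  shows "\<exists>F h. h \<in> homogeneous_part r (k * m) \<and> pairing F h \<noteq> 0 \<and>
    (\<forall>p. pairing F (linform r c * p) = 0) \<and>
    (\<forall>p. pairing F (linform r (\<lambda>_. 1) ^ Suc m * p) = 0) \<and>
    (\<forall>i p. pairing F (var i ^ Suc m * p) = 0)"
proof -
  obtain G where G: "G \<noteq> 0" "G \<in> homogeneous_part r k" "dirder r c G = 0"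
    "dirder r (\<lambda>_. 1) (dirder r (\<lambda>_. 1) G) = 0" "\<And>i. pd i (pd i G) = 0"
    using ex_multilinear_form[of k c] unfolding r_def by blast
  define F where "F = G ^ m"
  have "F \<noteq> 0" using G(1) by (simp add: F_def)
  then obtain \<alpha> where \<alpha>: "\<alpha> \<in> keys F" by fastforce
  moreover have "F \<in> homogeneous_part r (m * k)"
    unfolding F_def by (rule homogeneous_part_power[OF G(2)])
  ultimately have "single \<alpha> 1 \<in> homogeneous_part r (k * m)"
    by (auto simp: mem_homogeneous_part mult.commute)
  \<comment> \<open>Any monomial of \<open>F\<close> serves as \<open>h\<close>: the pairing is
    \<alpha>! times its coefficient, and \<alpha>! is nonzero in characteristic 0.\<close>
  moreover have "pairing F (single \<alpha> 1) \<noteq> 0"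
    using \<alpha> mfact_neq_0[of \<alpha>, where 'a='a] by (simp add: pairing_single in_keys_iff)
  moreover have "dirder r c F = 0"
  proof (cases m)
    case 0
    then show ?thesis by (simp add: F_def derivation_1[OF derivation_dirder])
  next
    case (Suc n)
    have "dirder r c (G ^ n) = 0" for n
      by (induction n) (simp_all add: derivation_1[OF derivation_dirder] derivation_mult[OF derivation_dirder] G)
    then show ?thesis by (simp add: F_def)
  qed
  then have "pairing F (linform r c * p) = 0" for p by (simp add: pairing_linform_mult)
  moreover have "pairing F (linform r (\<lambda>_. 1) ^ Suc m * p) = 0" for p
    unfolding pairing_linform_power_mult F_def
    by (subst derivation_funpow_power_eq_0[OF derivation_dirder G(4)]) auto
  moreover have "pairing F (var i ^ Suc m * p) = 0" for i p
    unfolding pairing_var_power_mult F_def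
    by (subst derivation_funpow_power_eq_0[OF derivation_pd G(5)]) auto
  ultimately show ?thesis by blast
qed

section \<open>The raising and lowering operators\<close>

text \<open>Membership in the monomial ideal (x_1^(m+1), ..., x_r^(m+1)), read off from the
  coefficients. Congruence modulo this predicate takes the place of computing in the quotient
  B.\<close>

definition overflow :: "nat \<Rightarrow> nat \<Rightarrow> (nat, 'a::comm_ring_1) mpoly \<Rightarrow> bool" where
  "overflow r m p \<longleftrightarrow> (\<forall>\<alpha>. (\<forall>i<r. lookup \<alpha> i \<le> m) \<longrightarrow> lookup p \<alpha> = 0)"

lemma const_numeral: "const (numeral n) = numeral n"
  using const_of_nat[of "numeral n"] by simp

lemma overflow_0: "overflow r m 0"
  and overflow_add: "overflow r m p \<Longrightarrow> overflow r m q \<Longrightarrow> overflow r m (p + q)"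
  and overflow_diff: "overflow r m p \<Longrightarrow> overflow r m q \<Longrightarrow> overflow r m (p - q)"
  by (simp_all add: overflow_def lookup_add lookup_minus)

lemma overflow_mult: "overflow r m p \<Longrightarrow> overflow r m (q * p)"
  unfolding overflow_def
proof (intro allI impI, rule ccontr)
  fix \<alpha> assume p: "\<forall>\<alpha>. (\<forall>i<r. lookup \<alpha> i \<le> m) \<longrightarrow> lookup p \<alpha> = 0"
    and \<alpha>: "\<forall>i<r. lookup \<alpha> i \<le> m" and "lookup (q * p) \<alpha> \<noteq> 0"
  then have "\<alpha> \<in> keys (q * p)" by (simp add: in_keys_iff)
  then obtain a b where ab: "\<alpha> = a + b" "b \<in> keys p" using keys_mult[of q p] by blast
  have "lookup b i \<le> lookup \<alpha> i" for i by (simp add: ab lookup_add)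
  then have "lookup p b = 0" using p \<alpha> by (meson order.trans)
  then show False using ab by (simp add: in_keys_iff)
qed

lemma overflow_const_mult_cancel:
  "overflow r m (const a * p) \<Longrightarrow> a \<noteq> 0 \<Longrightarrow> overflow r m (p :: (nat, 'a::idom) mpoly)"
  by (simp add: overflow_def)

text \<open>The lowering operator of an $\mathfrak{sl}_2$-action on $K[x_1,\dots,x_r]/(x_1^{m+1},\dots,x_r^{m+1})$
  whose raising operator is the multiplication by $x_1 + \dots + x_r$.\<close>

definition lowering :: "nat \<Rightarrow> nat \<Rightarrow> (nat, 'a::comm_ring_1) mpoly \<Rightarrow> (nat, 'a) mpoly" where
  "lowering r m p = (\<Sum>i<r. of_nat m * pd i p - var i * pd i (pd i p))"

abbreviation varsum :: "nat \<Rightarrow> (nat, 'a::comm_ring_1) mpoly" where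
  "varsum r \<equiv> linform r (\<lambda>_. 1)"

lemma pd_varsum: "i < r \<Longrightarrow> pd i (varsum r) = 1"
  by (simp add: linform_def pd_sum pd_var)

lemma lookup_of_nat_mult: "lookup (of_nat n * p) \<alpha> = of_nat n * lookup (p :: ('v, 'a::comm_ring_1) mpoly) \<alpha>"
  by (simp flip: const_of_nat)

lemma lookup_lowering:
  "lookup (lowering r m p) \<alpha> =
    (\<Sum>i<r. of_nat (Suc (lookup \<alpha> i)) * (of_nat m - of_nat (lookup \<alpha> i)) * lookup p (\<alpha> + expo i))"
  unfolding lowering_def lookup_sum
proof (rule sum.cong[OF refl])
  fix i
  have "lookup (var i * pd i (pd i p)) \<alpha> = of_nat (lookup \<alpha> i) * lookup (pd i p) \<alpha>"
  proof (cases "lookup \<alpha> i = 0")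
    case False
    then have "\<alpha> - expo i + expo i = \<alpha>" by (metis expo_add_diff add.commute)
    moreover have "Suc (lookup (\<alpha> - expo i) i) = lookup \<alpha> i" using False by (simp add: lookup_minus)
    ultimately show ?thesis using False by (simp add: lookup_var_mult lookup_pd[of i "pd i p"] del: of_nat_Suc)
  qed (simp add: lookup_var_mult)
  then show "lookup (of_nat m * pd i p - var i * pd i (pd i p)) \<alpha>
      = of_nat (Suc (lookup \<alpha> i)) * (of_nat m - of_nat (lookup \<alpha> i)) * lookup p (\<alpha> + expo i)"
    by (simp add: lookup_minus lookup_of_nat_mult lookup_pd algebra_simps)
qed

lemma lowering_add: "lowering r m (p + q) = lowering r m p + lowering r m q"
  by (rule poly_mapping_eqI) (simp add: lookup_lowering lookup_add distrib_left sum.distrib del: of_nat_Suc)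

lemma lowering_const_mult: "lowering r m (const a * p) = const a * lowering r m p"
  by (rule poly_mapping_eqI) (simp add: lookup_lowering sum_distrib_left mult.left_commute del: of_nat_Suc)

text \<open>The operator descends to B: at exponent m the raised monomial leaves the box, but its
  factor m - \<alpha>_i is zero there. The multiple \<open>of_nat m\<close> in
  \<open>lowering\<close> is tuned to this.\<close>

lemma overflow_lowering: "overflow r m p \<Longrightarrow> overflow r m (lowering r m p)"
  unfolding overflow_def lookup_lowering
proof (intro allI impI sum.neutral ballI)
  fix \<alpha> i assume p: "\<forall>\<alpha>. (\<forall>i<r. lookup \<alpha> i \<le> m) \<longrightarrow> lookup p \<alpha> = 0"
    and \<alpha>: "\<forall>i<r. lookup \<alpha> i \<le> m" and i: "i \<in> {..<r}"
  show "of_nat (Suc (lookup \<alpha> i)) * (of_nat m - of_nat (lookup \<alpha> i)) * lookup p (\<alpha> + expo i) = 0"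
  proof (cases "lookup \<alpha> i = m")
    case False
    then have "\<forall>j<r. lookup (\<alpha> + expo i) j \<le> m"
      using \<alpha> i by (auto simp: lookup_add lookup_single when_def Suc_le_eq le_neq_trans)
    then show ?thesis using p by simp
  qed simp
qed

lemma keys_lowering:
  assumes "\<alpha> \<in> keys (lowering r m p)"
  shows "\<exists>i. \<alpha> + expo i \<in> keys p"
proof (rule ccontr)
  assume "\<nexists>i. \<alpha> + expo i \<in> keys p"
  then have "lookup (lowering r m p) \<alpha> = 0" by (simp add: lookup_lowering in_keys_iff)
  then show False using assms by (simp add: in_keys_iff)
qed

lemma lowering_homogeneous:
  assumes "p \<in> homogeneous_part r (Suc d)"
  shows "lowering r m p \<in> homogeneous_part r d"
  unfolding mem_homogeneous_part
proof
  fix \<alpha> assume "\<alpha> \<in> keys (lowering r m p)"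
  then obtain i where "\<alpha> + expo i \<in> keys p" using keys_lowering by blast
  then have "keys (\<alpha> + expo i) \<subseteq> {..<r}" "mdegree (\<alpha> + expo i) = Suc d"
    using assms by (auto simp: mem_homogeneous_part)
  moreover have "keys \<alpha> \<subseteq> keys (\<alpha> + expo i)" by (auto simp: in_keys_iff lookup_add)
  ultimately show "keys \<alpha> \<subseteq> {..<r} \<and> mdegree \<alpha> = d" by (simp add: mdegree_add)
qed

lemma lowering_homogeneous_0:
  assumes "p \<in> homogeneous_part r 0"
  shows "lowering r m p = 0"
proof -
  have "keys (lowering r m p) = {}"
  proof (rule ccontr)
    assume "keys (lowering r m p) \<noteq> {}"
    then obtain \<alpha> i where "\<alpha> + expo i \<in> keys p" using keys_lowering by blast
    then have "mdegree (\<alpha> + expo i) = 0" using assms by (simp add: mem_homogeneous_part)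
    then show False by (simp add: mdegree_add)
  qed
  then show ?thesis by simp
qed

section \<open>The commutation relation and injectivity below the middle degree\<close>

lemma euler_identity:
  assumes "p \<in> homogeneous_part r d"
  shows "(\<Sum>i<r. var i * pd i p) = of_nat d * p"
proof (rule poly_mapping_eqI)
  fix \<alpha>
  have "lookup (var i * pd i p) \<alpha> = of_nat (lookup \<alpha> i) * lookup p \<alpha>" for i
  proof (cases "lookup \<alpha> i = 0")
    case False
    then have "\<alpha> - expo i + expo i = \<alpha>" by (metis expo_add_diff add.commute)
    moreover have "Suc (lookup (\<alpha> - expo i) i) = lookup \<alpha> i" using False by (simp add: lookup_minus)
    ultimately show ?thesis using False by (simp add: lookup_var_mult lookup_pd del: of_nat_Suc)
  qed (simp add: lookup_var_mult)
  then have eq: "lookup (\<Sum>i<r. var i * pd i p) \<alpha> = of_nat (\<Sum>i<r. lookup \<alpha> i) * lookup p \<alpha>"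
    by (simp add: lookup_sum sum_distrib_right)
  show "lookup (\<Sum>i<r. var i * pd i p) \<alpha> = lookup (of_nat d * p) \<alpha>"
  proof (cases "\<alpha> \<in> keys p")
    case True
    then have "(\<Sum>i<r. lookup \<alpha> i) = d"
      using assms mdegree_superset[of "{..<r}" \<alpha>] by (simp add: mem_homogeneous_part)
    then show ?thesis unfolding eq by (simp add: lookup_of_nat_mult)
  next
    case False
    then show ?thesis unfolding eq by (simp add: lookup_of_nat_mult in_keys_iff)
  qed
qed

text \<open>Since each partial derivative D_i of L is 1, the i-th summand m D_i - x_i D_i^2 has
  commutator m - 2 x_i D_i with L, and Euler's identity adds these up to the weight r m - 2
  d.\<close>

lemma lowering_varsum_mult:
  assumes "p \<in> homogeneous_part r d"
  shows "lowering r m (varsum r * p) = varsum r * lowering r m p + const (of_nat (r * m) - 2 * of_nat d) * p"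
proof -
  have "lowering r m (varsum r * p) = (\<Sum>i<r. varsum r * (of_nat m * pd i p - var i * pd i (pd i p))
      + (of_nat m * p - 2 * (var i * pd i p)))"
    unfolding lowering_def
    by (rule sum.cong[OF refl]) (simp add: pd_mult pd_varsum pd_add algebra_simps)
  also have "\<dots> = varsum r * lowering r m p + (of_nat r * (of_nat m * p) - 2 * (of_nat d * p))"
    by (simp only: sum.distrib sum_subtractf sum_distrib_left[symmetric] lowering_def euler_identity[OF assms])
      simp
  finally show ?thesis
    by (simp add: const_add const_uminus const_mult const_of_nat const_numeral diff_conv_add_uminus distrib_right del: add_uminus_conv_diff)
qed

text \<open>Moving powers of the lowering operator E past L gives E^n L p = L E^n p + \<kappa>_n
  E^(n-1) p, where \<kappa>_n > 0 for n > 0 because d is below the middle. So if L p vanishes in B,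
  the vanishing of E^(l+1) p implies that of E^l p. The descent starts at E^(d+1) p, which is zero
  for reasons of degree, and ends at p.\<close>

lemma overflow_varsum_mult_cancel:
  fixes p :: "(nat, 'a::field_char_0) mpoly"
  assumes p: "p \<in> homogeneous_part r d" and d: "2 * d < r * m" and ov: "overflow r m (varsum r * p)"
  shows "overflow r m p"
proof -
  define E :: "(nat, 'a) mpoly \<Rightarrow> (nat, 'a) mpoly" where "E = lowering r m"
  define H where "H = r * m - 2 * d"
  have H: "r * m = H + 2 * d" "H > 0" using d by (auto simp: H_def)
  \<comment> \<open>The sum of H + 2 j over j < n, where H + 2 j is the weight of E^j p.\<close>
  define \<kappa> where "\<kappa> n = n * H + n * (n - 1)" for n
  have hom: "(E ^^ n) p \<in> homogeneous_part r (d - n)" if "n \<le> d" for n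
    using that
  proof (induction n)
    case (Suc n)
    then have "(E ^^ n) p \<in> homogeneous_part r (Suc (d - Suc n))" by (simp add: Suc_diff_Suc)
    then show ?case by (simp add: E_def lowering_homogeneous)
  qed (simp add: p)
  have comm: "(E ^^ n) (varsum r * p) = varsum r * (E ^^ n) p + const (of_nat (\<kappa> n)) * (E ^^ (n - 1)) p"
    if "n \<le> Suc d" for n
    using that
  proof (induction n)
    case (Suc n)
    define q where "q = (E ^^ n) p"
    have q: "q \<in> homogeneous_part r (d - n)" using hom Suc by (simp add: q_def)
    have 1: "const (of_nat (\<kappa> n)) * E ((E ^^ (n - 1)) p) = const (of_nat (\<kappa> n)) * q"
      unfolding q_def by (cases n) (auto simp: \<kappa>_def)
    have "int (\<kappa> (Suc n)) = int (\<kappa> n) + (int (r * m) - 2 * int (d - n))"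
      unfolding H(1) using Suc.prems by (cases n) (simp_all add: \<kappa>_def of_nat_diff algebra_simps)
    then have "(of_int (int (\<kappa> (Suc n))) :: 'a) = of_int (int (\<kappa> n) + (int (r * m) - 2 * int (d - n)))"
      by simp
    then have 2: "(of_nat (\<kappa> (Suc n)) :: 'a) = of_nat (\<kappa> n) + (of_nat (r * m) - 2 * of_nat (d - n))"
      by (simp del: of_nat_mult)
    have "(E ^^ Suc n) (varsum r * p) = E (varsum r * q + const (of_nat (\<kappa> n)) * (E ^^ (n - 1)) p)"
      using Suc by (simp add: q_def)
    also have "\<dots> = E (varsum r * q) + const (of_nat (\<kappa> n)) * q"
      unfolding 1[symmetric] by (simp add: E_def lowering_add lowering_const_mult)
    also have "\<dots> = varsum r * E q + const (of_nat (\<kappa> (Suc n))) * q"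
      unfolding E_def lowering_varsum_mult[OF q] 2 const_add by (simp add: distrib_right)
    finally show ?case by (simp add: q_def)
  qed (simp add: \<kappa>_def)
  have ovn: "overflow r m ((E ^^ n) (varsum r * p))" for n
    by (induction n) (simp_all add: ov E_def overflow_lowering)
  have "overflow r m ((E ^^ (Suc d - n)) p)" if "n \<le> Suc d" for n
    using that
  proof (induction n)
    case 0
    have "(E ^^ Suc d) p = 0" using hom[of d] by (simp add: E_def lowering_homogeneous_0)
    then show ?case by (simp add: overflow_0)
  next
    case (Suc n)
    define l where "l = d - n"
    have l: "Suc d - n = Suc l" "Suc d - Suc n = l" "Suc l \<le> Suc d" using Suc.prems by (auto simp: l_def)
    have "overflow r m ((E ^^ Suc l) (varsum r * p) - varsum r * (E ^^ Suc l) p)"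
      using Suc ovn[of "Suc l"] unfolding l(1) by (intro overflow_diff overflow_mult) auto
    also have "(E ^^ Suc l) (varsum r * p) - varsum r * (E ^^ Suc l) p = const (of_nat (\<kappa> (Suc l))) * (E ^^ l) p"
      using comm[OF l(3)] by simp
    finally show ?case
      unfolding l using H(2) by (rule_tac overflow_const_mult_cancel) (auto simp: \<kappa>_def simp del: of_nat_Suc of_nat_add)
  qed
  from this[of "Suc d"] show ?thesis by simp
qed

text \<open>The last factor acts on degree d + n - 1, and only there must twice the degree stay
  below r m; hence the bound \<open>Suc (r * m)\<close> on 2 (d + n).\<close>

lemma overflow_varsum_power_cancel:
  fixes p :: "(nat, 'a::field_char_0) mpoly"
  assumes "p \<in> homogeneous_part r d" "2 * (d + n) \<le> Suc (r * m)" "overflow r m (varsum r ^ n * p)"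
  shows "overflow r m p"
  using assms
proof (induction n)
  case (Suc n)
  have "varsum r ^ n * p \<in> homogeneous_part r (n * 1 + d)"
    by (intro homogeneous_part_mult homogeneous_part_power linform_homogeneous Suc.prems)
  then have "overflow r m (varsum r ^ n * p)"
    by (rule overflow_varsum_mult_cancel) (use Suc.prems in \<open>simp_all add: mult.assoc\<close>)
  with Suc show ?case by simp
qed simp

section \<open>Monomials with bounded exponents\<close>

definition box :: "nat \<Rightarrow> nat \<Rightarrow> nat \<Rightarrow> (nat \<Rightarrow>\<^sub>0 nat) set" where
  "box r m d = {\<alpha>. keys \<alpha> \<subseteq> {..<r} \<and> (\<forall>i<r. lookup \<alpha> i \<le> m) \<and> mdegree \<alpha> = d}"

text \<open>The coefficient of z^d in (1 + z + ... + z^m)^n. Degrees are integers so that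
  differences can be taken without truncation.\<close>

fun cnt :: "nat \<Rightarrow> nat \<Rightarrow> int \<Rightarrow> int" where
  "cnt m 0 d = (if d = 0 then 1 else 0)"
| "cnt m (Suc n) d = (\<Sum>i\<le>m. cnt m n (d - int i))"

lemma cnt_neg: "d < 0 \<Longrightarrow> cnt m n d = 0"
  by (induction n arbitrary: d) auto

lemma box_Suc: "box (Suc n) m d = (\<Union>i\<in>{..min m d}. (\<lambda>\<alpha>. \<alpha> + single n i) ` box n m (d - i))"
proof (intro equalityI subsetI)
  fix \<alpha> assume \<alpha>: "\<alpha> \<in> box (Suc n) m d"
  define i where "i = lookup \<alpha> n"
  define \<beta> where "\<beta> = \<alpha> - single n i"
  have eq: "\<alpha> = \<beta> + single n i"
    by (rule poly_mapping_eqI) (simp add: \<beta>_def i_def lookup_add lookup_minus lookup_single when_def)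
  have \<beta>: "lookup \<beta> j = (if j = n then 0 else lookup \<alpha> j)" for j
    by (simp add: \<beta>_def i_def lookup_minus lookup_single when_def)
  have "mdegree (single n i) = i" by (simp add: mdegree_def)
  then have "d = mdegree \<beta> + i" using \<alpha> eq by (simp add: box_def mdegree_add)
  moreover have "i \<le> m" using \<alpha> by (simp add: box_def i_def)
  moreover have "keys \<beta> \<subseteq> {..<n}"
  proof
    fix j assume "j \<in> keys \<beta>"
    then have "j \<noteq> n" "j \<in> keys \<alpha>" using \<beta>[of j] by (auto simp: in_keys_iff split: if_splits)
    then show "j \<in> {..<n}" using \<alpha> by (auto simp: box_def less_Suc_eq)
  qed
  ultimately have "i \<in> {..min m d}" "\<beta> \<in> box n m (d - i)" using \<alpha> by (auto simp: box_def \<beta>)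
  then show "\<alpha> \<in> (\<Union>i\<in>{..min m d}. (\<lambda>\<alpha>. \<alpha> + single n i) ` box n m (d - i))" using eq by blast
next
  fix \<alpha> assume "\<alpha> \<in> (\<Union>i\<in>{..min m d}. (\<lambda>\<alpha>. \<alpha> + single n i) ` box n m (d - i))"
  then obtain i \<beta> where i: "i \<le> m" "i \<le> d" and \<beta>: "\<beta> \<in> box n m (d - i)" and \<alpha>: "\<alpha> = \<beta> + single n i" by auto
  have "n \<notin> keys \<beta>" using \<beta> by (auto simp: box_def)
  then have "lookup \<beta> n = 0" by (simp add: in_keys_iff)
  moreover have "keys \<alpha> \<subseteq> insert n (keys \<beta>)" unfolding \<alpha> using Poly_Mapping.keys_add[of \<beta> "single n i"] by (auto split: if_splits)
  moreover have "mdegree (single n i) = i" by (simp add: mdegree_def)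
  ultimately show "\<alpha> \<in> box (Suc n) m d"
    using \<beta> i unfolding box_def \<alpha>
    by (auto simp: mdegree_add lookup_add lookup_single when_def less_Suc_eq)
qed

lemma box_0: "box 0 m d = (if d = 0 then {0} else {})"
  by (auto simp: box_def)

lemma finite_box: "finite (box n m d)"
  by (induction n arbitrary: d) (auto simp: box_0 box_Suc)

lemma card_box: "int (card (box n m d)) = cnt m n (int d)"
proof (induction n arbitrary: d)
  case (Suc n)
  have n: "lookup \<alpha> n = 0" if "\<alpha> \<in> box n m e" for \<alpha> e
  proof -
    have "n \<notin> keys \<alpha>" using that by (auto simp: box_def)
    then show ?thesis by (simp add: in_keys_iff)
  qed
  have "card (box (Suc n) m d) = (\<Sum>i\<in>{..min m d}. card ((\<lambda>\<alpha>. \<alpha> + single n i) ` box n m (d - i)))"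
    unfolding box_Suc
  proof (rule card_UN_disjoint)
    show "\<forall>i\<in>{..min m d}. \<forall>j\<in>{..min m d}. i \<noteq> j \<longrightarrow>
        (\<lambda>\<alpha>. \<alpha> + single n i) ` box n m (d - i) \<inter> (\<lambda>\<alpha>. \<alpha> + single n j) ` box n m (d - j) = {}"
    proof (intro ballI impI, rule ccontr)
      fix i j assume "i \<noteq> j" "(\<lambda>\<alpha>. \<alpha> + single n i) ` box n m (d - i) \<inter> (\<lambda>\<alpha>. \<alpha> + single n j) ` box n m (d - j) \<noteq> {}"
      then obtain \<alpha> \<beta> where "\<alpha> \<in> box n m (d - i)" "\<beta> \<in> box n m (d - j)" "\<alpha> + single n i = \<beta> + single n j" by auto
      then have "lookup (\<alpha> + single n i) n = lookup (\<beta> + single n j) n" "lookup \<alpha> n = 0" "lookup \<beta> n = 0"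
        using n by auto
      then show False using \<open>i \<noteq> j\<close> by (simp add: lookup_add)
    qed
  qed (auto simp: finite_box)
  also have "\<dots> = (\<Sum>i\<in>{..min m d}. card (box n m (d - i)))"
    by (intro sum.cong refl card_image) (simp add: inj_on_def)
  finally have "int (card (box (Suc n) m d)) = (\<Sum>i\<in>{..min m d}. cnt m n (int d - int i))"
    by (simp add: Suc of_nat_diff)
  also have "\<dots> = (\<Sum>i\<le>m. cnt m n (int d - int i))"
    by (rule sum.mono_neutral_left) (auto intro!: cnt_neg)
  finally show ?case by simp
qed (simp add: box_0)

text \<open>Multiplying the generating function by 1 - z turns one factor 1 + z + ... + z^m into 1 -
  z^(m+1).\<close>

lemma cnt_diff: "cnt m (Suc n) d - cnt m (Suc n) (d - 1) = cnt m n d - cnt m n (d - int m - 1)"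
proof -
  have "(\<Sum>i\<le>l. cnt m n (d - int i)) - (\<Sum>i\<le>l. cnt m n (d - 1 - int i)) = cnt m n d - cnt m n (d - int l - 1)" for l
  proof (induction l)
    case (Suc l)
    have "d - 1 - int (Suc l) = d - int (Suc l) - 1" "d - int l - 1 = d - int (Suc l)" by simp_all
    then show ?case using Suc by (simp only: sum.atMost_Suc)
  qed (simp add: algebra_simps)
  then show ?thesis by simp
qed

lemma cnt_sym: "cnt m n (int n * int m - d) = cnt m n d"
proof (induction n arbitrary: d)
  case (Suc n)
  have "cnt m (Suc n) (int (Suc n) * int m - d) = (\<Sum>i\<le>m. cnt m n (int n * int m - (d - int (m - i))))"
    by (auto simp: of_nat_diff algebra_simps intro!: sum.cong)
  also have "\<dots> = (\<Sum>i\<le>m. cnt m n (d - int (m - i)))" by (simp only: Suc)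
  also have "\<dots> = (\<Sum>i\<le>m. cnt m n (d - int i))"
    using sum.atLeastAtMost_rev[of "\<lambda>i. cnt m n (d - int i)" 0 m] by (simp add: atMost_atLeast0)
  finally show ?case by simp
qed auto

text \<open>Unimodality: up to the middle, a difference of consecutive values is by
  \<open>cnt_diff\<close> a difference in one variable fewer, nonnegative by induction. A degree
  beyond the middle is first reflected by \<open>cnt_sym\<close>.\<close>

lemma cnt_mono: "d' \<le> d \<Longrightarrow> d + d' \<le> int n * int m \<Longrightarrow> cnt m n d' \<le> cnt m n d"
proof (induction n arbitrary: d d')
  case 0
  then show ?case by auto
next
  case (Suc n)
  let ?f = "cnt m (Suc n)"
  have step: "?f (e - 1) \<le> ?f e" if "2 * e \<le> int (Suc n) * int m" for e
    using cnt_diff[of m n e] Suc.IH[of "e - int m - 1" e] that by (simp add: algebra_simps del: cnt.simps)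
  have mono: "?f (e - int l) \<le> ?f e" if "2 * e \<le> int (Suc n) * int m" for e l
  proof (induction l)
    case (Suc l)
    have "?f (e - int l - 1) \<le> ?f (e - int l)" by (rule step, rule order.trans[OF _ that]) simp
    moreover have eq: "e - int (Suc l) = e - int l - 1" by simp
    ultimately show ?case using Suc unfolding eq by linarith
  qed simp
  show ?case
  proof (cases "2 * d \<le> int (Suc n) * int m")
    case True
    then show ?thesis using mono[of d "nat (d - d')"] Suc.prems by (simp del: cnt.simps)
  next
    case False
    define e where "e = int (Suc n) * int m - d"
    obtain Z where Z: "Z = int (Suc n) * int m" by blast
    have "2 * e \<le> int (Suc n) * int m"
      using False unfolding e_def Z[symmetric] by arith
    moreover have "d' \<le> e"
      using Suc.prems unfolding e_def Z[symmetric] by linarith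
    ultimately have "?f d' \<le> ?f e"
      using mono[of e "nat (e - d')"] by (simp del: cnt.simps of_nat_Suc)
    also have "?f e = ?f d" unfolding e_def by (rule cnt_sym)
    finally show ?thesis .
  qed
qed

section \<open>Differences of the counts at and below the middle\<close>

lemma cnt_1: "cnt m (Suc 0) d = (if 0 \<le> d \<and> d \<le> int m then 1 else 0)"
proof -
  have "cnt m (Suc 0) d = (\<Sum>i\<le>m. if i = nat d \<and> 0 \<le> d then 1 else 0)"
    unfolding cnt.simps by (rule sum.cong) auto
  then show ?thesis by (cases "0 \<le> d") (auto simp: sum.delta nat_le_iff)
qed

lemma cnt_2: "l \<le> m \<Longrightarrow> cnt m (Suc (Suc 0)) (int l) = int l + 1"
proof (induction l)
  case 0
  then show ?case using cnt_diff[of m "Suc 0" 0] by (simp only: cnt_1) (simp add: cnt_neg del: cnt.simps)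
next
  case (Suc l)
  then show ?case using cnt_diff[of m "Suc 0" "int (Suc l)"] by (simp only: cnt_1) (simp del: cnt.simps)
qed

text \<open>Two variables are added by way of the count \<open>u\<close> in 2k + 1 variables.
  Degrees q and q + M are symmetric for \<open>u\<close>, which collapses the first difference of
  \<open>b\<close> to a single step of \<open>u\<close>; the second difference spans m + 1
  consecutive steps.\<close>

lemma cnt_middle_step:
  fixes k m :: nat
  defines "a \<equiv> cnt m (2 * k)" and "b \<equiv> cnt m (2 * Suc k)" and "q \<equiv> int k * int m" and "M \<equiv> int m"
  shows "b (q + M) - b (q + M - 1) = a q - a (q - M - 1)"
    and "b (q - 1) - b (q - 2) = (\<Sum>i\<le>m. a (q - 1 - int i) - a (q - 1 - int i - M - 1))"
    and "i \<le> m \<Longrightarrow> a (q - 1 - int i) - a (q - 1 - int i - M - 1) \<ge> 0"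
proof -
  define u where "u = cnt m (Suc (2 * k))"
  have b: "b d - b (d - 1) = u d - u (d - M - 1)" for d
    unfolding b_def u_def M_def using cnt_diff[of m "Suc (2 * k)" d] by (simp del: cnt.simps)
  have u: "u d - u (d - 1) = a d - a (d - M - 1)" for d
    unfolding u_def a_def M_def by (rule cnt_diff)
  have "u (q + M) = u q"
    unfolding u_def M_def q_def using cnt_sym[of m "Suc (2 * k)" "int k * int m"] by (simp add: algebra_simps del: cnt.simps)
  then show "b (q + M) - b (q + M - 1) = a q - a (q - M - 1)"
    using b[of "q + M"] u[of q] by simp
  have "u e - u (e - int l) = (\<Sum>i<l. a (e - int i) - a (e - int i - M - 1))" for e l
  proof (induction l)
    case (Suc l)
    have eq: "e - int (Suc l) = e - int l - 1" by simp
    show ?case using Suc u[of "e - int l"] unfolding eq sum.lessThan_Suc by linarith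
  qed simp
  from this[of "q - 1" "Suc m"] b[of "q - 1"]
  show "b (q - 1) - b (q - 2) = (\<Sum>i\<le>m. a (q - 1 - int i) - a (q - 1 - int i - M - 1))"
    by (simp add: M_def lessThan_Suc_atMost algebra_simps)
  assume "i \<le> m"
  show "a (q - 1 - int i) - a (q - 1 - int i - M - 1) \<ge> 0"
    unfolding a_def using cnt_mono[of "q - 1 - int i - M - 1" "q - 1 - int i" "2 * k" m] by (simp add: q_def M_def)
qed

text \<open>Rearranged, the inequality for k says that the left side for k + 1 is less than the
  summand i = 0 of the right side, and the other summands are nonnegative. For k = 2 the two sides
  are m + 1 and m (m + 1) / 2, so m \<ge> 3 is exactly what the start needs.\<close>

lemma cnt_middle:
  assumes "k \<ge> 2" "m \<ge> 3"
  shows "cnt m (2 * k) (int k * int m) - cnt m (2 * k) (int k * int m - 1)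
    < cnt m (2 * k) (int k * int m - int m - 1) - cnt m (2 * k) (int k * int m - int m - 2)"
  using assms(1)
proof (induction k rule: dec_induct)
  case base
  note [simp del] = cnt.simps
  define f where "f i = cnt m 2 (int m - 1 - int i) - cnt m 2 (int m - 1 - int i - int m - 1)" for i
  have f: "f i = int m - int i" if "i < m" for i
    using cnt_2[of "m - 1 - i" m] that by (simp add: f_def cnt_neg of_nat_diff numeral_2_eq_2 diff_diff_eq)
  have nn: "f i \<ge> 0" if "i \<le> m" for i
    using cnt_middle_step(3)[where k=1 and m=m and i=i] that by (simp add: f_def)
  have "int m + 1 < f 0 + f 1" using f[of 0] f[of 1] assms by simp
  also have "\<dots> = (\<Sum>i\<in>{0,1}. f i)" by simp
  also have "\<dots> \<le> (\<Sum>i\<le>m. f i)" by (rule sum_mono2) (use nn assms in auto)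
  finally have "int m + 1 < (\<Sum>i\<le>m. f i)" .
  moreover have "cnt m 2 (int m) = int m + 1" using cnt_2[of m m] by (simp add: numeral_2_eq_2)
  ultimately show ?case
    using cnt_middle_step(1,2)[where k=1 and m=m] by (simp add: f_def cnt_neg numeral_2_eq_2 algebra_simps)
next
  case (step k)
  define f where "f i = cnt m (2 * k) (int k * int m - 1 - int i) - cnt m (2 * k) (int k * int m - 1 - int i - int m - 1)" for i
  have nn: "f i \<ge> 0" if "i \<le> m" for i
    using cnt_middle_step(3)[where k=k and m=m and i=i] that by (simp add: f_def)
  have "f 0 \<le> (\<Sum>i\<le>m. f i)" using sum_mono2[of "{..m}" "{0}" f] nn by simp
  then show ?case
    using step.IH cnt_middle_step(1,2)[where k=k and m=m] by (simp add: f_def algebra_simps del: cnt.simps)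
qed

lemma card_box_middle:
  assumes "k \<ge> 2" "m \<ge> 3" and c: "Suc c = k * m"
  shows "card (box (2 * k) m (Suc c)) + card (box (2 * k) m (c - Suc m))
    < card (box (2 * k) m c) + card (box (2 * k) m (c - m))"
proof -
  have "Suc (Suc m) \<le> 2 * m" using assms by simp
  also have "\<dots> \<le> Suc c" unfolding c using assms by simp
  \<comment> \<open>Ensures that neither \<open>c - m\<close> nor \<open>c - Suc m\<close> is
    truncated.\<close>
  finally have le: "Suc m \<le> c" by simp
  have q: "int k * int m = int c + 1" using c by (metis of_nat_Suc of_nat_mult add.commute)
  have "int (card (box (2 * k) m (Suc c)) + card (box (2 * k) m (c - Suc m)))
      < int (card (box (2 * k) m c) + card (box (2 * k) m (c - m)))"
    unfolding of_nat_add card_box using cnt_middle[OF assms(1,2)] le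
    by (simp add: q of_nat_diff algebra_simps)
  then show ?thesis by simp
qed

section \<open>The dimension count\<close>

definition keep :: "('k \<Rightarrow> bool) \<Rightarrow> ('k \<Rightarrow>\<^sub>0 'c) \<Rightarrow> 'k \<Rightarrow>\<^sub>0 'c::zero" where
  "keep P p = Poly_Mapping.mapp (\<lambda>\<alpha> c. if P \<alpha> then c else 0) p"

lemma lookup_keep: "lookup (keep P p) \<alpha> = (if P \<alpha> then lookup p \<alpha> else 0)"
  by (simp add: keep_def lookup_mapp when_def in_keys_iff)

lemma keep_0 [simp]: "keep P 0 = 0"
  by (rule poly_mapping_eqI) (simp add: lookup_keep)

lemma keys_keep: "keys (keep P p) = {\<alpha>\<in>keys p. P \<alpha>}"
  by (auto simp: in_keys_iff lookup_keep split: if_splits)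

lemma keep_add: "keep P (p + q) = keep P p + keep P q"
  by (rule poly_mapping_eqI) (simp add: lookup_keep lookup_add)

lemma keep_const_mult: "keep P (const a * p) = const a * keep P p"
  by (rule poly_mapping_eqI) (simp add: lookup_keep)

lemma keep_diff: "keep P (p - q) = keep P p - keep P (q :: 'k \<Rightarrow>\<^sub>0 'c::ab_group_add)"
  by (rule poly_mapping_eqI) (simp add: lookup_keep lookup_minus)

lemma keep_eq_self_iff: "keep P p = p \<longleftrightarrow> (\<forall>\<alpha>\<in>keys p. P \<alpha>)"
  by (auto simp: poly_mapping_eq_iff fun_eq_iff lookup_keep in_keys_iff)

lemma keys_minus_eq: "keys (- p) = keys (p :: 'k \<Rightarrow>\<^sub>0 'c::ab_group_add)"
  by (auto simp: in_keys_iff)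

text \<open>The normal form modulo the monomial ideal: elements of B are represented by polynomials
  supported in a box.\<close>

abbreviation trunc :: "nat \<Rightarrow> nat \<Rightarrow> (nat, 'a::comm_ring_1) mpoly \<Rightarrow> (nat, 'a) mpoly" where
  "trunc r m \<equiv> keep (\<lambda>\<alpha>. \<forall>i<r. lookup \<alpha> i \<le> m)"

abbreviation hcomp :: "nat \<Rightarrow> (nat, 'a::comm_ring_1) mpoly \<Rightarrow> (nat, 'a) mpoly" where
  "hcomp d \<equiv> keep (\<lambda>\<alpha>. mdegree \<alpha> = d)"

lemma trunc_eq_0_iff: "trunc r m p = 0 \<longleftrightarrow> overflow r m p"
  by (auto simp: poly_mapping_eq_iff fun_eq_iff lookup_keep overflow_def)

lemma overflow_diff_trunc: "overflow r m (p - trunc r m p)"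
  by (simp add: overflow_def lookup_minus lookup_keep)

lemma overflow_hcomp: "overflow r m p \<Longrightarrow> overflow r m (hcomp d p)"
  by (simp add: overflow_def lookup_keep)

lemma keys_trunc_homogeneous: "p \<in> homogeneous_part r d \<Longrightarrow> keys (trunc r m p) \<subseteq> box r m d"
  by (auto simp: keys_keep mem_homogeneous_part box_def)

lemma homogeneous_part_keys_box: "keys p \<subseteq> box r m d \<Longrightarrow> p \<in> homogeneous_part r d"
  by (auto simp: mem_homogeneous_part box_def)

lemma trunc_eq_self: "keys p \<subseteq> box r m d \<Longrightarrow> trunc r m p = p"
  by (auto simp: keep_eq_self_iff box_def)

section \<open>Linear algebra on spans of monomials\<close>

global_interpretation mpoly: vector_space "\<lambda>(a::'a::field) p :: ('v, 'a) mpoly. const a * p"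
  by unfold_locales (simp_all add: distrib_left distrib_right const_add const_mult mult.assoc)

lemma mpoly_linearI:
  fixes f :: "('v, 'a::field) mpoly \<Rightarrow> ('w, 'a) mpoly"
  assumes "\<And>p q. f (p + q) = f p + f q" "\<And>a p. f (const a * p) = const a * f p"
  shows "Vector_Spaces.linear (\<lambda>a p. const a * p) (\<lambda>a p. const a * p) f"
  using assms by unfold_locales auto

lemma mpoly_span_monomials:
  assumes "finite X"
  shows "mpoly.span ((\<lambda>\<alpha>. single \<alpha> (1::'a::field)) ` X) = {p. keys p \<subseteq> X}"
proof (intro equalityI subsetI)
  fix p :: "('b, 'a) mpoly" assume p: "p \<in> {p. keys p \<subseteq> X}"
  have "(\<Sum>\<alpha>\<in>keys p. const (lookup p \<alpha>) * single \<alpha> 1) \<in> mpoly.span ((\<lambda>\<alpha>. single \<alpha> 1) ` X)"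
    using p by (intro mpoly.span_sum mpoly.span_scale mpoly.span_base) auto
  then show "p \<in> mpoly.span ((\<lambda>\<alpha>. single \<alpha> 1) ` X)"
    by (subst poly_mapping_sum_single) (simp add: const_mult_single)
next
  fix p :: "('b, 'a) mpoly" assume "p \<in> mpoly.span ((\<lambda>\<alpha>. single \<alpha> 1) ` X)"
  then have "keys p \<subseteq> X"
  proof (induction rule: mpoly.span_induct_alt)
    case (step c x y)
    have "keys (const c * x) \<subseteq> keys x" by (auto simp: in_keys_iff)
    moreover have "keys x \<subseteq> X" using step by auto
    ultimately show ?case using step Poly_Mapping.keys_add[of "const c * x" y] by blast
  qed simp
  then show "p \<in> {p. keys p \<subseteq> X}" by simp
qed

lemma mpoly_independent_monomials: "mpoly.independent ((\<lambda>\<alpha>. single \<alpha> (1::'a::field)) ` X)"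
proof -
  have "u v = 0" if t: "finite t" "t \<subseteq> (\<lambda>\<alpha>. single \<alpha> (1::'a)) ` X" and 0: "(\<Sum>v\<in>t. const (u v) * v) = 0" and v: "v \<in> t"
    for t :: "('b, 'a) mpoly set" and u :: "('b, 'a) mpoly \<Rightarrow> 'a" and v
  proof -
    obtain \<alpha> where \<alpha>: "v = single \<alpha> 1" using t v by auto
    have "0 = lookup (\<Sum>v\<in>t. const (u v) * v) \<alpha>" by (simp add: 0)
    also have "\<dots> = (\<Sum>w\<in>t. if w = v then u v else 0)"
      unfolding lookup_sum
    proof (rule sum.cong[OF refl])
      fix w assume "w \<in> t"
      then obtain \<beta> where "w = single \<beta> 1" using t by auto
      then show "lookup (const (u w) * w) \<alpha> = (if w = v then u v else 0)"
        by (auto simp: \<alpha> lookup_single when_def) (metis lookup_single_eq lookup_single_not_eq zero_neq_one)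
    qed
    finally show ?thesis using t v by simp
  qed
  then show ?thesis unfolding mpoly.dependent_explicit by blast
qed

lemma card_monomials: "card ((\<lambda>\<alpha>. single \<alpha> (1::'a::zero_neq_one)) ` X) = card X"
proof (rule card_image, rule inj_onI)
  fix \<alpha> \<beta> :: 'b assume "single \<alpha> (1::'a) = single \<beta> 1"
  then have "keys (single \<alpha> (1::'a)) = keys (single \<beta> (1::'a))" by simp
  then show "\<alpha> = \<beta>" by simp
qed

text \<open>Otherwise the images of the monomials in \<open>X\<close> would be independent vectors
  in a span of fewer monomials.\<close>

lemma ex_kernel_element:
  fixes \<Theta> :: "('v, 'a::field) mpoly \<Rightarrow> ('w, 'a) mpoly"
  assumes lin: "Vector_Spaces.linear (\<lambda>a p. const a * p) (\<lambda>a p. const a * p) \<Theta>"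
    and fin: "finite X" "finite Y" and card: "card Y < card X"
    and map: "\<And>p. keys p \<subseteq> X \<Longrightarrow> keys (\<Theta> p) \<subseteq> Y"
  shows "\<exists>p. p \<noteq> 0 \<and> keys p \<subseteq> X \<and> \<Theta> p = 0"
proof (rule ccontr)
  assume "\<nexists>p. p \<noteq> 0 \<and> keys p \<subseteq> X \<and> \<Theta> p = 0"
  then have 0: "p = 0" if "keys p \<subseteq> X" "\<Theta> p = 0" for p using that by blast
  interpret \<Theta>: Vector_Spaces.linear "\<lambda>a p :: ('v, 'a) mpoly. const a * p" "\<lambda>a p :: ('w, 'a) mpoly. const a * p" \<Theta>
    by (rule lin)
  let ?B = "(\<lambda>\<alpha>. single \<alpha> (1::'a)) ` X" and ?C = "(\<lambda>\<alpha>. single \<alpha> (1::'a)) ` Y"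
  have span: "mpoly.span ?B = {p. keys p \<subseteq> X}" by (rule mpoly_span_monomials[OF fin(1)])
  have inj: "inj_on \<Theta> (mpoly.span ?B)"
    unfolding \<Theta>.inj_on_iff_eq_0[OF mpoly.subspace_span] using 0 span by auto
  have "mpoly.independent (\<Theta> ` ?B)"
    by (rule \<Theta>.independent_injective_image[OF mpoly_independent_monomials inj])
  moreover have "\<Theta> ` ?B \<subseteq> mpoly.span ?C"
  proof -
    have "keys (single \<alpha> (1::'a)) \<subseteq> X" if "\<alpha> \<in> X" for \<alpha> using that by simp
    then show ?thesis unfolding mpoly_span_monomials[OF fin(2)] using map by blast
  qed
  ultimately have "card (\<Theta> ` ?B) \<le> card ?C"
    using mpoly.independent_span_bound[of ?C "\<Theta> ` ?B"] fin by simp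
  moreover have "card (\<Theta> ` ?B) = card ?B"
    by (rule card_image) (rule inj_on_subset[OF inj mpoly.span_superset])
  ultimately show False using card by (simp add: card_monomials)
qed

lemma ex_left_inverse:
  fixes T :: "('v, 'a::field) mpoly \<Rightarrow> ('w, 'a) mpoly"
  assumes lin: "Vector_Spaces.linear (\<lambda>a p. const a * p) (\<lambda>a p. const a * p) T"
    and fin: "finite X" and inj: "\<And>p. keys p \<subseteq> X \<Longrightarrow> T p = 0 \<Longrightarrow> p = 0"
  shows "\<exists>S. Vector_Spaces.linear (\<lambda>a p. const a * p) (\<lambda>a p. const a * p) S \<and>
    (\<forall>p. keys (S p) \<subseteq> X) \<and> (\<forall>p. keys p \<subseteq> X \<longrightarrow> S (T p) = p)"
proof -
  interpret vector_space_pair "\<lambda>a p :: ('v, 'a) mpoly. const a * p" "\<lambda>a p :: ('w, 'a) mpoly. const a * p"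
    by unfold_locales
  let ?V = "mpoly.span ((\<lambda>\<alpha>. single \<alpha> (1::'a)) ` X)"
  have V: "?V = {p. keys p \<subseteq> X}" by (rule mpoly_span_monomials[OF fin])
  have "inj_on T ?V"
    unfolding linear_inj_on_iff_eq_0[OF lin mpoly.subspace_span] using inj V by auto
  then obtain S where "S ` UNIV \<subseteq> ?V" "Vector_Spaces.linear (\<lambda>a p. const a * p) (\<lambda>a p. const a * p) S"
    "\<forall>v\<in>?V. S (T v) = v"
    using linear_exists_left_inverse_on[OF lin mpoly.subspace_span] by blast
  then show ?thesis unfolding V by (intro exI[of _ S]) auto
qed

text \<open>Let t = m + 1 and let S be a left inverse of multiplication by L^t on B_(c-t). The map
  that sends (f, g) in B_c x B_(c-m) to (l f - L^t g, S f) has more monomials in its source than in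
  its target, hence a nonzero kernel element. It satisfies l f = L^t g in B. If f were L^t q, then q
  = S f = 0, so f = 0, and g = 0 by injectivity of L^t. Thus f is nonzero modulo L^t while l f is
  not.\<close>

lemma ex_multiplication_kernel:
  fixes l :: "(nat, 'a::field_char_0) mpoly"
  assumes k: "k \<ge> 2" "m \<ge> 3" and c: "Suc c = k * m" and r: "r = 2 * k" and l: "l \<in> homogeneous_part r 1"
  shows "\<exists>f g. f \<in> homogeneous_part r c \<and> overflow r m (l * f - varsum r ^ Suc m * g) \<and>
    (\<forall>q \<in> homogeneous_part r (c - Suc m). \<not> overflow r m (f - varsum r ^ Suc m * q)) \<and>
    g \<in> homogeneous_part r (c - m)"
proof -
  let ?L = "varsum r :: (nat, 'a) mpoly"
  define T where "T p = trunc r m (?L ^ Suc m * p)" for p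
  have "Suc (Suc m) \<le> 2 * m" using k by simp
  also have "\<dots> \<le> Suc c" unfolding c using k by simp
  finally have le: "Suc m \<le> c" by simp
  have rm: "r * m = 2 * Suc c" using r c by simp
  have Lp: "?L ^ Suc m * p \<in> homogeneous_part r (Suc m + d)" if "p \<in> homogeneous_part r d" for p d
    using homogeneous_part_mult[OF homogeneous_part_power[OF linform_homogeneous, where n="Suc m"] that] by simp
  \<comment> \<open>The bound just covers both uses: L^t takes degree c - m to the middle degree k m
    and degree c - m - 1 to the one below it.\<close>
  have Tinj: "p = 0" if "keys p \<subseteq> box r m d" "2 * (d + Suc m) \<le> Suc (r * m)" "T p = 0" for p d
  proof -
    have "overflow r m p"
      using overflow_varsum_power_cancel[OF homogeneous_part_keys_box[OF that(1)] that(2)] that(3)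
      by (simp add: T_def trunc_eq_0_iff)
    then show ?thesis using trunc_eq_self[OF that(1)] by (simp add: trunc_eq_0_iff[symmetric])
  qed
  have Tlin: "Vector_Spaces.linear (\<lambda>a p. const a * p) (\<lambda>a p. const a * p) T"
    by (rule mpoly_linearI) (simp_all only: T_def keep_add keep_const_mult distrib_left mult.left_commute[of _ "const _"])
  obtain S where S: "Vector_Spaces.linear (\<lambda>a p. const a * p) (\<lambda>a p. const a * p) S"
      "\<And>p. keys (S p) \<subseteq> box r m (c - Suc m)"
      "\<And>p. keys p \<subseteq> box r m (c - Suc m) \<Longrightarrow> S (T p) = p"
    using ex_left_inverse[OF Tlin finite_box, of r m "c - Suc m"] Tinj[of _ "c - Suc m"] le rm by auto
  interpret S: Vector_Spaces.linear "\<lambda>a p :: (nat, 'a) mpoly. const a * p" "\<lambda>a p :: (nat, 'a) mpoly. const a * p" S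
    by (rule S(1))
  \<comment> \<open>Pairs are coded as sums of two forms: the degrees c and c - m of the source
    differ, and so do the degrees c + 1 and c - m - 1 of the target.\<close>
  define \<Theta> where "\<Theta> h = trunc r m (l * hcomp c h) - T (hcomp (c - m) h) + S (hcomp c h)" for h
  let ?X = "box r m c \<union> box r m (c - m)" and ?Y = "box r m (Suc c) \<union> box r m (c - Suc m)"
  have disj: "box r m d \<inter> box r m e = {}" if "d \<noteq> e" for d e using that by (auto simp: box_def)
  have \<Theta>lin: "Vector_Spaces.linear (\<lambda>a p. const a * p) (\<lambda>a p. const a * p) \<Theta>"
    by (rule mpoly_linearI)
      (simp_all only: \<Theta>_def T_def keep_add keep_const_mult S.add S.scale distrib_left mult.left_commute[of _ "const _"]
        right_diff_distrib add_diff_add, simp_all add: algebra_simps)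
  have comp: "keys (hcomp d h) \<subseteq> box r m d" if "keys h \<subseteq> ?X" for h d
    using that by (auto simp: keys_keep box_def)
  have range1: "keys (trunc r m (l * hcomp c h) - T (hcomp (c - m) h)) \<subseteq> box r m (Suc c)"
    if "keys h \<subseteq> ?X" for h
  proof -
    have "l * hcomp c h \<in> homogeneous_part r (Suc c)"
      using homogeneous_part_mult[OF l homogeneous_part_keys_box[OF comp[OF that]]] by simp
    moreover have "?L ^ Suc m * hcomp (c - m) h \<in> homogeneous_part r (Suc c)"
      using Lp[OF homogeneous_part_keys_box[OF comp[OF that]], of "c - m"] le by simp
    ultimately show ?thesis
      unfolding T_def keep_diff[symmetric] by (intro keys_trunc_homogeneous homogeneous_part_diff)
  qed
  have range: "keys (\<Theta> h) \<subseteq> ?Y" if "keys h \<subseteq> ?X" for h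
    using range1[OF that] S(2)[of "hcomp c h"]
      Poly_Mapping.keys_add[of "trunc r m (l * hcomp c h) - T (hcomp (c - m) h)" "S (hcomp c h)"]
    unfolding \<Theta>_def by blast
  have "m \<noteq> 0" using k by simp
  have "card ?Y = card (box r m (Suc c)) + card (box r m (c - Suc m))"
    by (rule card_Un_disjoint) (auto simp: finite_box disj)
  moreover have "card ?X = card (box r m c) + card (box r m (c - m))"
    by (rule card_Un_disjoint) (use le \<open>m \<noteq> 0\<close> in \<open>auto simp: finite_box disj\<close>)
  ultimately have "card ?Y < card ?X" using card_box_middle[OF k c] r by simp
  then obtain h where h: "h \<noteq> 0" "keys h \<subseteq> ?X" "\<Theta> h = 0"
    using ex_kernel_element[OF \<Theta>lin, of ?X ?Y] range finite_box by blast
  define f where "f = hcomp c h"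
  define g where "g = hcomp (c - m) h"
  have f: "keys f \<subseteq> box r m c" and g: "keys g \<subseteq> box r m (c - m)" using comp[OF h(2)] by (auto simp: f_def g_def)
  have hfg: "h = f + g"
  proof (rule poly_mapping_eqI)
    fix \<alpha>
    have "\<alpha> \<notin> keys h" if "mdegree \<alpha> \<noteq> c" "mdegree \<alpha> \<noteq> c - m" using that h(2) by (auto simp: box_def)
    moreover have "c \<noteq> c - m" using le \<open>m \<noteq> 0\<close> by simp
    ultimately show "lookup h \<alpha> = lookup (f + g) \<alpha>"
      by (auto simp: f_def g_def lookup_add lookup_keep in_keys_iff)
  qed
  have eq: "trunc r m (l * f) - T g = - S f"
    using h(3) by (simp add: \<Theta>_def f_def g_def eq_neg_iff_add_eq_0)
  \<comment> \<open>Both sides of \<open>eq\<close> are supported in different degrees, so each of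
    them is zero.\<close>
  have "keys (trunc r m (l * f) - T g) \<subseteq> box r m (Suc c)" using range1[OF h(2)] by (simp add: f_def g_def)
  moreover have "keys (- S f) \<subseteq> box r m (c - Suc m)" using S(2) by simp
  moreover have "box r m (Suc c) \<inter> box r m (c - Suc m) = {}" by (rule disj) simp
  ultimately have "keys (S f) = {}" unfolding eq keys_minus_eq by blast
  then have Sf: "S f = 0" by simp
  then have lf: "trunc r m (l * f) = T g" using eq by simp
  have "overflow r m (l * f - ?L ^ Suc m * g)"
    unfolding trunc_eq_0_iff[symmetric] keep_diff using lf by (simp add: T_def)
  moreover have "\<not> overflow r m (f - ?L ^ Suc m * q)" if q: "q \<in> homogeneous_part r (c - Suc m)" for q
  proof
    assume ov: "overflow r m (f - ?L ^ Suc m * q)"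
    \<comment> \<open>The left inverse \<open>S\<close> recovers only normal forms, so
      \<open>q\<close> is reduced modulo the monomial ideal.\<close>
    define q' where "q' = trunc r m q"
    have q': "keys q' \<subseteq> box r m (c - Suc m)" unfolding q'_def by (rule keys_trunc_homogeneous[OF q])
    have "overflow r m (f - ?L ^ Suc m * q + ?L ^ Suc m * (q - q'))"
      unfolding q'_def by (intro overflow_add ov overflow_mult overflow_diff_trunc)
    then have "overflow r m (f - ?L ^ Suc m * q')" by (simp add: algebra_simps)
    then have fT: "f = T q'"
      unfolding trunc_eq_0_iff[symmetric] keep_diff T_def using trunc_eq_self[OF f] by simp
    then have "q' = 0" using S(3)[OF q'] Sf by simp
    then have "f = 0" by (simp add: fT T_def)
    moreover have "T g = 0" using lf \<open>f = 0\<close> by simp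
    then have "g = 0" by (rule Tinj[OF g, rotated]) (use le rm in simp)
    ultimately show False using h(1) hfg by simp
  qed
  ultimately show ?thesis
    using homogeneous_part_keys_box[OF f] homogeneous_part_keys_box[OF g] by blast
qed

section \<open>The power ideal\<close>

lemma carrier_poly_ring: "carrier (poly_ring r) = {p. indets p \<subseteq> {..<r}}"
  and poly_ring_mult [simp]: "x \<otimes>\<^bsub>poly_ring r\<^esub> y = x * y"
  and poly_ring_add [simp]: "x \<oplus>\<^bsub>poly_ring r\<^esub> y = x + y"
  and poly_ring_zero [simp]: "\<zero>\<^bsub>poly_ring r\<^esub> = 0"
  and poly_ring_one [simp]: "\<one>\<^bsub>poly_ring r\<^esub> = 1"
  by (simp_all add: poly_ring_def)

lemma homogeneous_part_carrier: "p \<in> homogeneous_part r d \<Longrightarrow> p \<in> carrier (poly_ring r)"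
  by (simp add: homogeneous_part_def)

lemma indets_0 [simp]: "indets 0 = {}" and indets_1 [simp]: "indets 1 = {}"
  and indets_const [simp]: "indets (const a) = {}"
  by (auto simp: indets_def const_def)

lemma indets_uminus [simp]: "indets (- p) = indets (p :: ('v, 'a::comm_ring_1) mpoly)"
  by (simp add: indets_def keys_minus_eq)

lemma indets_var: "indets (var i) \<subseteq> {i}"
  by (auto simp: indets_def var_def split: if_splits)

lemma indets_diff: "indets (p - q) \<subseteq> indets p \<union> indets (q :: ('v, 'a::comm_ring_1) mpoly)"
  using indets_add[of p "- q"] by simp

lemma indets_sum: "(\<And>i. i \<in> A \<Longrightarrow> indets (f i) \<subseteq> V) \<Longrightarrow> indets (sum f A) \<subseteq> V"
proof (induction A rule: infinite_finite_induct)
  case (insert i A)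
  then show ?case using indets_add[of "f i" "sum f A"] by (simp add: le_sup_iff) blast
qed auto

lemma indets_prod: "(\<And>i. i \<in> A \<Longrightarrow> indets (f i) \<subseteq> V) \<Longrightarrow> indets (prod f A) \<subseteq> V"
proof (induction A rule: infinite_finite_induct)
  case (insert i A)
  then show ?case using indets_mult[of "f i" "prod f A"] by simp blast
qed auto

lemma indets_power: "indets (p ^ n) \<subseteq> indets p"
proof (induction n)
  case (Suc n)
  then show ?case using indets_mult[of p "p ^ n"] by auto
qed simp

lemma carrier_poly_ring_closed:
  assumes "p \<in> carrier (poly_ring r)" "q \<in> carrier (poly_ring r)"
  shows "p + q \<in> carrier (poly_ring r)" "p - q \<in> carrier (poly_ring r)" "p * q \<in> carrier (poly_ring r)"
    "- p \<in> carrier (poly_ring r)"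
  using assms indets_add[of p q] indets_diff[of p q] indets_mult[of p q]
  by (auto simp: carrier_poly_ring)

lemma carrier_poly_ring_power: "p \<in> carrier (poly_ring r) \<Longrightarrow> p ^ n \<in> carrier (poly_ring r)"
  using indets_power[of p n] by (auto simp: carrier_poly_ring)

lemma carrier_poly_ring_0: "0 \<in> carrier (poly_ring r)"
  and carrier_poly_ring_1: "1 \<in> carrier (poly_ring r)"
  by (simp_all add: carrier_poly_ring)

lemma poly_ring_a_inv:
  assumes "p \<in> carrier (poly_ring r)"
  shows "\<ominus>\<^bsub>poly_ring r\<^esub> p = - p"
proof -
  interpret cring "poly_ring r :: (nat, 'a) mpoly ring" by (rule cring_poly_ring)
  show ?thesis by (rule minus_equality) (use assms carrier_poly_ring_closed in auto)
qed

lemma ideal_poly_ringI: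
  assumes "J \<subseteq> carrier (poly_ring r)" "0 \<in> J" "\<And>p q. p \<in> J \<Longrightarrow> q \<in> J \<Longrightarrow> p + q \<in> J"
    and mult: "\<And>p q. p \<in> J \<Longrightarrow> q \<in> carrier (poly_ring r) \<Longrightarrow> q * p \<in> J"
  shows "ideal J (poly_ring r :: (nat, 'a::comm_ring_1) mpoly ring)"
proof -
  interpret cring "poly_ring r :: (nat, 'a) mpoly ring" by (rule cring_poly_ring)
  have uminus: "- p \<in> J" if "p \<in> J" for p
  proof -
    have "- 1 * p \<in> J" by (rule mult[OF that]) (simp add: carrier_poly_ring)
    then show ?thesis by simp
  qed
  show ?thesis
  proof (rule idealI)
    show "subgroup J (add_monoid (poly_ring r))"
    proof (rule add.subgroupI)
      fix p assume "p \<in> J"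
      then show "\<ominus>\<^bsub>poly_ring r\<^esub> p \<in> J" using assms(1) uminus by (simp add: poly_ring_a_inv subset_iff)
    qed (use assms in auto)
  qed (use assms mult in \<open>auto simp: mult.commute ring_axioms\<close>)
qed

context
  fixes r :: nat and I :: "(nat, 'a::comm_ring_1) mpoly set"
  assumes I: "ideal I (poly_ring r)"
begin

lemma ideal_poly_ring_closed:
  shows "p \<in> I \<Longrightarrow> p \<in> carrier (poly_ring r)"
    and "0 \<in> I"
    and "p \<in> I \<Longrightarrow> q \<in> I \<Longrightarrow> p + q \<in> I"
    and "p \<in> I \<Longrightarrow> q \<in> carrier (poly_ring r) \<Longrightarrow> q * p \<in> I"
    and "p \<in> I \<Longrightarrow> - p \<in> I"
proof -
  interpret ideal I "poly_ring r" by (rule I)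
  show "p \<in> I \<Longrightarrow> p \<in> carrier (poly_ring r)" by (rule a_Hcarr)
  show "0 \<in> I" using additive_subgroup.zero_closed[OF additive_subgroup_axioms] by simp
  show "p \<in> I \<Longrightarrow> q \<in> I \<Longrightarrow> p + q \<in> I" using additive_subgroup.a_closed[OF additive_subgroup_axioms, of p q] by simp
  show "p \<in> I \<Longrightarrow> q \<in> carrier (poly_ring r) \<Longrightarrow> q * p \<in> I" using I_l_closed[of p q] by simp
  show "p \<in> I \<Longrightarrow> - p \<in> I"
    using I_l_closed[of p "- 1"] by (simp add: carrier_poly_ring)
qed

lemma ideal_poly_ring_sum: "(\<And>i. i \<in> A \<Longrightarrow> f i \<in> I) \<Longrightarrow> sum f A \<in> I"
  by (induction A rule: infinite_finite_induct) (auto intro: ideal_poly_ring_closed(2,3))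

lemma coset_eq_iff: "I +>\<^bsub>poly_ring r\<^esub> f = I +>\<^bsub>poly_ring r\<^esub> g \<longleftrightarrow> f - g \<in> I"
proof -
  have coset: "I +>\<^bsub>poly_ring r\<^esub> f = (\<lambda>h. h + f) ` I" for f
    by (auto simp: a_r_coset_def')
  show ?thesis
  proof
    assume eq: "I +>\<^bsub>poly_ring r\<^esub> f = I +>\<^bsub>poly_ring r\<^esub> g"
    have "f \<in> (\<lambda>h. h + f) ` I" using ideal_poly_ring_closed(2) by force
    then obtain h where "h \<in> I" "f = h + g" using eq coset by auto
    then show "f - g \<in> I" by simp
  next
    assume fg: "f - g \<in> I"
    show "I +>\<^bsub>poly_ring r\<^esub> f = I +>\<^bsub>poly_ring r\<^esub> g"
      unfolding coset
    proof (intro equalityI image_subsetI)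
      fix h assume "h \<in> I"
      then have "h + (f - g) \<in> I" "h + - (f - g) \<in> I" using fg ideal_poly_ring_closed(3,5) by blast+
      moreover have "h + f = h + (f - g) + g" "h + g = h + - (f - g) + f" by simp_all
      ultimately show "h + f \<in> (\<lambda>h. h + g) ` I" "h + g \<in> (\<lambda>h. h + f) ` I" by blast+
    qed
  qed
qed

lemma mult_map_coset:
  assumes "f \<in> carrier (poly_ring r)" "g \<in> carrier (poly_ring r)"
  shows "mult_map r I f (I +>\<^bsub>poly_ring r\<^esub> g) = I +>\<^bsub>poly_ring r\<^esub> (f * g)"
  using ideal.rcoset_mult_add[OF I assms] by (simp add: mult_map_def FactRing_def)

text \<open>Turns the claim about maps between sets of cosets into two statements about forms in S,
  which is all that the rest of the proof deals with.\<close>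

lemma not_weak_lefschetz_in_degreeI:
  assumes not_inj: "\<And>l. l \<in> homogeneous_part r 1 \<Longrightarrow> \<exists>f\<in>homogeneous_part r m. f \<notin> I \<and> l * f \<in> I"
    and not_surj: "\<And>l. l \<in> homogeneous_part r 1 \<Longrightarrow>
      \<exists>h\<in>homogeneous_part r (Suc m). \<forall>f\<in>homogeneous_part r m. h - l * f \<notin> I"
  shows "\<not> weak_lefschetz_in_degree r I m"
proof
  assume "weak_lefschetz_in_degree r I m"
  then obtain l where l: "l \<in> homogeneous_part r 1" and
    "inj_on (mult_map r I l) (quot_part r I m) \<or> mult_map r I l ` quot_part r I m = quot_part r I (Suc m)"
    by (auto simp: weak_lefschetz_in_degree_def)
  then consider "inj_on (mult_map r I l) (quot_part r I m)"
    | "mult_map r I l ` quot_part r I m = quot_part r I (Suc m)" by blast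
  then show False
  proof cases
    case 1
    obtain f where f: "f \<in> homogeneous_part r m" "f \<notin> I" "l * f \<in> I" using not_inj[OF l] by blast
    have "mult_map r I l (I +>\<^bsub>poly_ring r\<^esub> f) = mult_map r I l (I +>\<^bsub>poly_ring r\<^esub> 0)"
      using f l by (simp add: mult_map_coset homogeneous_part_carrier carrier_poly_ring_0 coset_eq_iff)
    moreover have "I +>\<^bsub>poly_ring r\<^esub> f \<in> quot_part r I m" "I +>\<^bsub>poly_ring r\<^esub> 0 \<in> quot_part r I m"
      using f homogeneous_part_0 by (auto simp: quot_part_def)
    ultimately have "I +>\<^bsub>poly_ring r\<^esub> f = I +>\<^bsub>poly_ring r\<^esub> 0" using inj_onD[OF 1] by blast
    then show False using f by (simp add: coset_eq_iff)
  next
    case 2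
    obtain h where h: "h \<in> homogeneous_part r (Suc m)" "\<forall>f\<in>homogeneous_part r m. h - l * f \<notin> I"
      using not_surj[OF l] by blast
    then have "I +>\<^bsub>poly_ring r\<^esub> h \<in> mult_map r I l ` quot_part r I m"
      unfolding 2 by (auto simp: quot_part_def)
    then obtain f where "f \<in> homogeneous_part r m" "I +>\<^bsub>poly_ring r\<^esub> h = mult_map r I l (I +>\<^bsub>poly_ring r\<^esub> f)"
      by (auto simp: quot_part_def)
    then show False
      using h l by (simp add: mult_map_coset homogeneous_part_carrier coset_eq_iff)
  qed
qed

end

lemma ideal_power_ideal:
  assumes "\<And>i. i < s \<Longrightarrow> l i \<in> carrier (poly_ring r)"
  shows "ideal (power_ideal r s t l) (poly_ring r)"
    and "i < s \<Longrightarrow> l i ^ t \<in> power_ideal r s t l"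
proof -
  interpret cring "poly_ring r :: (nat, 'a) mpoly ring" by (rule cring_poly_ring)
  have gens: "(\<lambda>i. l i ^ t) ` {..<s} \<subseteq> carrier (poly_ring r)"
    using assms carrier_poly_ring_power by auto
  show "ideal (power_ideal r s t l) (poly_ring r)"
    unfolding power_ideal_def by (rule genideal_ideal[OF gens])
  show "i < s \<Longrightarrow> l i ^ t \<in> power_ideal r s t l"
    using genideal_self[OF gens] by (auto simp: power_ideal_def)
qed

lemma power_ideal_subset:
  assumes "ideal J (poly_ring r)" "\<And>i. i < s \<Longrightarrow> l i ^ t \<in> J"
  shows "power_ideal r s t l \<subseteq> J"
proof -
  interpret cring "poly_ring r :: (nat, 'a) mpoly ring" by (rule cring_poly_ring)
  show ?thesis unfolding power_ideal_def by (rule genideal_minimal) (use assms in auto)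
qed

section \<open>The standard tuple of linear forms\<close>

definition std_forms :: "nat \<Rightarrow> nat \<Rightarrow> (nat, 'a::comm_ring_1) mpoly" where
  "std_forms r i = (if i < r then var i else varsum r)"

lemma std_forms_homogeneous: "std_forms r i \<in> homogeneous_part r 1"
  by (simp add: std_forms_def var_homogeneous linform_homogeneous del: One_nat_def)

lemma std_forms_power_carrier: "std_forms r i ^ n \<in> carrier (poly_ring r)"
  by (rule carrier_poly_ring_power[OF homogeneous_part_carrier[OF std_forms_homogeneous]])

lemma var_power: "var i ^ n = single (single i n) 1"
proof (induction n)
  case (Suc n)
  have "expo i + single i n = single i (Suc n)" by (simp add: single_add[symmetric])
  then show ?case by (simp add: Suc var_mult_single)
qed simp

lemma overflow_var_power:
  assumes "i < r"
  shows "overflow r m (var i ^ Suc m)"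
  unfolding overflow_def var_power
proof (intro allI impI)
  fix \<alpha> assume \<alpha>: "\<forall>i<r. lookup \<alpha> i \<le> m"
  have "lookup (single i (Suc m)) i > m" by simp
  then have "single i (Suc m) \<noteq> \<alpha>" using \<alpha> assms by (metis not_le)
  then show "lookup (single (single i (Suc m)) (1::'a)) \<alpha> = 0" by (simp add: lookup_single)
qed

text \<open>Membership of a form in the ideal yields an arbitrary cofactor of L^t; this allows
  replacing it by a homogeneous component.\<close>

lemma hcomp_mult:
  assumes "p \<in> homogeneous_part r e"
  shows "hcomp (e + d) (p * q) = p * hcomp d q"
proof (induction q rule: poly_mapping_additive_induct)
  case zero
  then show ?case by (simp add: keep_eq_self_iff)
next
  case (add q q')
  then show ?case by (simp add: distrib_left keep_add)
next
  case (single \<beta> b)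
  have deg: "mdegree \<alpha> = e + mdegree \<beta>" if \<alpha>: "\<alpha> \<in> keys (p * single \<beta> b)" for \<alpha>
  proof -
    obtain x y where "\<alpha> = x + y" "x \<in> keys p" "y \<in> keys (single \<beta> b)" using \<alpha> keys_mult[of p "single \<beta> b"] by blast
    then show ?thesis using assms by (auto simp: mem_homogeneous_part mdegree_add split: if_splits)
  qed
  show ?case
  proof (cases "mdegree \<beta> = d")
    case True
    then have "hcomp (e + d) (p * single \<beta> b) = p * single \<beta> b" using deg by (auto simp: keep_eq_self_iff)
    moreover have "hcomp d (single \<beta> b) = single \<beta> b" using True by (auto simp: keep_eq_self_iff)
    ultimately show ?thesis by simp
  next
    case False
    then have "keys (hcomp (e + d) (p * single \<beta> b)) = {}" using deg by (auto simp: keys_keep)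
    moreover have "keys (hcomp d (single \<beta> b)) = {}" using False by (auto simp: keys_keep)
    ultimately show ?thesis by simp
  qed
qed

lemma hcomp_homogeneous: "p \<in> carrier (poly_ring r) \<Longrightarrow> hcomp d p \<in> homogeneous_part r d"
  by (auto simp: mem_homogeneous_part keys_keep carrier_poly_ring indets_def)

text \<open>The polynomials with this property form an ideal that contains the generators: the power
  of a variable overflows, so q = 0 works, and for the power of L one takes q = 1.\<close>

lemma std_power_ideal_decompose:
  assumes "p \<in> power_ideal r (r + 1) (Suc m) (std_forms r)"
  shows "\<exists>q \<in> carrier (poly_ring r). overflow r m (p - varsum r ^ Suc m * q)"
proof -
  let ?L = "varsum r :: (nat, 'a) mpoly"
  define J where "J = {p \<in> carrier (poly_ring r). \<exists>q \<in> carrier (poly_ring r). overflow r m (p - ?L ^ Suc m * q)}"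
  have "ideal J (poly_ring r)"
  proof (rule ideal_poly_ringI)
    show "0 \<in> J" unfolding J_def using carrier_poly_ring_0 by (force simp: overflow_0)
    show "p + p' \<in> J" if p: "p \<in> J" "p' \<in> J" for p p'
    proof -
      obtain q q' where q: "q \<in> carrier (poly_ring r)" "q' \<in> carrier (poly_ring r)"
        "overflow r m (p - ?L ^ Suc m * q)" "overflow r m (p' - ?L ^ Suc m * q')"
        using p unfolding J_def by blast
      have "overflow r m ((p - ?L ^ Suc m * q) + (p' - ?L ^ Suc m * q'))" using q by (intro overflow_add)
      then have "overflow r m (p + p' - ?L ^ Suc m * (q + q'))" by (simp only: distrib_left add_diff_add)
      then show ?thesis unfolding J_def using p q carrier_poly_ring_closed(1) by (auto simp: J_def)
    qed
    show "x * p \<in> J" if p: "p \<in> J" and x: "x \<in> carrier (poly_ring r)" for p x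
    proof -
      obtain q where q: "q \<in> carrier (poly_ring r)" "overflow r m (p - ?L ^ Suc m * q)"
        using p unfolding J_def by blast
      have "overflow r m (x * (p - ?L ^ Suc m * q))" by (rule overflow_mult[OF q(2)])
      then have "overflow r m (x * p - ?L ^ Suc m * (x * q))" by (simp only: right_diff_distrib mult.left_commute[of x])
      then show ?thesis unfolding J_def using p q x carrier_poly_ring_closed(3) by (auto simp: J_def)
    qed
  qed (auto simp: J_def)
  moreover have "std_forms r i ^ Suc m \<in> J" if "i < r + 1" for i
  proof (cases "i < r")
    case True
    then have "overflow r m (std_forms r i ^ Suc m - ?L ^ Suc m * 0)"
      using overflow_var_power[OF True, of m] by (simp add: std_forms_def)
    then show ?thesis
      unfolding J_def using carrier_poly_ring_0 std_forms_power_carrier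
      by blast
  next
    case False
    then have "overflow r m (std_forms r i ^ Suc m - ?L ^ Suc m * 1)"
      by (simp add: std_forms_def overflow_0)
    then show ?thesis
      unfolding J_def using carrier_poly_ring_1 std_forms_power_carrier
      by blast
  qed
  ultimately have "power_ideal r (r + 1) (Suc m) (std_forms r) \<subseteq> J" by (rule power_ideal_subset)
  then show ?thesis using assms by (auto simp: J_def)
qed

lemma overflow_in_std_power_ideal:
  assumes p: "p \<in> carrier (poly_ring r)" and ov: "overflow r m p"
  shows "p \<in> power_ideal r (r + 1) (Suc m) (std_forms r)"
proof -
  let ?I = "power_ideal r (r + 1) (Suc m) (std_forms r) :: (nat, 'a) mpoly set"
  have I: "ideal ?I (poly_ring r)" and gen: "i < r + 1 \<Longrightarrow> std_forms r i ^ Suc m \<in> ?I" for i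
    using ideal_power_ideal[of "r + 1" "std_forms r" r] homogeneous_part_carrier[OF std_forms_homogeneous] by blast+
  have "single \<alpha> (lookup p \<alpha>) \<in> ?I" if \<alpha>: "\<alpha> \<in> keys p" for \<alpha>
  proof -
    obtain i where i: "i < r" "lookup \<alpha> i > m"
      using ov \<alpha> unfolding overflow_def by (metis in_keys_iff not_le)
    define \<beta> where "\<beta> = \<alpha> - single i (Suc m)"
    have eq: "\<alpha> = \<beta> + single i (Suc m)"
      by (rule poly_mapping_eqI) (use i in \<open>auto simp: \<beta>_def lookup_add lookup_minus lookup_single when_def\<close>)
    have "keys \<beta> \<subseteq> keys \<alpha>" by (auto simp: \<beta>_def in_keys_iff lookup_minus)
    moreover have "keys \<alpha> \<subseteq> {..<r}" using p \<alpha> by (auto simp: carrier_poly_ring indets_def)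
    ultimately have "keys \<beta> \<subseteq> {..<r}" by blast
    then have "indets (single \<beta> (lookup p \<alpha>)) \<subseteq> {..<r}" by (simp add: indets_def)
    then have "single \<beta> (lookup p \<alpha>) * std_forms r i ^ Suc m \<in> ?I"
      using gen[of i] i by (intro ideal_poly_ring_closed(4)[OF I]) (auto simp: carrier_poly_ring)
    also have "single \<beta> (lookup p \<alpha>) * std_forms r i ^ Suc m = single \<alpha> (lookup p \<alpha>)"
      using i eq by (simp add: std_forms_def var_power mult_single del: power_Suc)
    finally show ?thesis .
  qed
  then have "(\<Sum>\<alpha>\<in>keys p. single \<alpha> (lookup p \<alpha>)) \<in> ?I" by (rule ideal_poly_ring_sum[OF I])
  then show ?thesis using poly_mapping_sum_single[of p] by simp
qed

lemma std_not_injective: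
  fixes l :: "(nat, 'a::field_char_0) mpoly" and k m r c :: nat
  assumes k: "k \<ge> 2" "m \<ge> 3" and c: "Suc c = k * m" and r: "r = 2 * k" and l: "l \<in> homogeneous_part r 1"
  defines "I \<equiv> power_ideal r (r + 1) (Suc m) (std_forms r)"
  shows "\<exists>f\<in>homogeneous_part r c. f \<notin> I \<and> l * f \<in> I"
proof -
  let ?L = "varsum r :: (nat, 'a) mpoly"
  have I: "ideal I (poly_ring r)" and gen: "i < r + 1 \<Longrightarrow> std_forms r i ^ Suc m \<in> I" for i
    unfolding I_def using ideal_power_ideal[of "r + 1" "std_forms r" r] homogeneous_part_carrier[OF std_forms_homogeneous] by blast+
  obtain f g where f: "f \<in> homogeneous_part r c" and g: "g \<in> homogeneous_part r (c - m)"
    and fg: "overflow r m (l * f - ?L ^ Suc m * g)"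
    and nf: "\<And>q. q \<in> homogeneous_part r (c - Suc m) \<Longrightarrow> \<not> overflow r m (f - ?L ^ Suc m * q)"
    using ex_multiplication_kernel[OF k c r l] by blast
  have "2 * m \<le> Suc c" unfolding c using k by simp
  then have le: "Suc m \<le> c" using k by simp
  have L: "?L ^ Suc m \<in> homogeneous_part r (Suc m)"
    using homogeneous_part_power[OF linform_homogeneous, where n="Suc m"] by simp
  note carr = homogeneous_part_carrier
  have Lg: "?L ^ Suc m * g \<in> I"
    using ideal_poly_ring_closed(4)[OF I gen[of r] carr[OF g]] by (simp add: std_forms_def mult.commute del: power_Suc)
  have "l * f - ?L ^ Suc m * g \<in> I"
    unfolding I_def
    by (rule overflow_in_std_power_ideal[OF _ fg])
      (intro carrier_poly_ring_closed(2,3) carr[OF f] carr[OF g] carr[OF L] carr[OF l])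
  from ideal_poly_ring_closed(3)[OF I this Lg] have "l * f \<in> I" by simp
  moreover have "f \<notin> I"
  proof
    assume "f \<in> I"
    then obtain q where q: "q \<in> carrier (poly_ring r)" "overflow r m (f - ?L ^ Suc m * q)"
      unfolding I_def using std_power_ideal_decompose by blast
    have "hcomp c f = f" using f by (auto simp: keep_eq_self_iff mem_homogeneous_part)
    moreover have "hcomp c (?L ^ Suc m * q) = ?L ^ Suc m * hcomp (c - Suc m) q"
      using hcomp_mult[OF L, of "c - Suc m" q] le by simp
    ultimately have "overflow r m (f - ?L ^ Suc m * hcomp (c - Suc m) q)"
      using overflow_hcomp[OF q(2), of c] by (simp add: keep_diff)
    then show False using nf hcomp_homogeneous[OF q(1)] by blast
  qed
  ultimately show ?thesis using f by blast
qed

lemma std_not_surjective: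
  fixes l :: "(nat, 'a::field_char_0) mpoly" and k m r :: nat
  assumes r: "r = 2 * k" and l: "l \<in> homogeneous_part r 1"
  defines "I \<equiv> power_ideal r (r + 1) (Suc m) (std_forms r)"
  shows "\<exists>h\<in>homogeneous_part r (k * m). \<forall>f. h - l * f \<notin> I"
proof -
  obtain F h where h: "h \<in> homogeneous_part r (k * m)" "pairing F h \<noteq> 0"
    and F: "\<And>p. pairing F (l * p) = 0" "\<And>p. pairing F (varsum r ^ Suc m * p) = 0"
      "\<And>i p. pairing F (var i ^ Suc m * p) = 0"
    using ex_inverse_system[of k m "\<lambda>i. lookup l (expo i)"] homogeneous_part_1_linform[OF l]
    unfolding r by metis
  \<comment> \<open>The kernel of \<open>pairing F\<close> is only a subspace. \<open>K\<close> is
    the annihilator of F, an ideal, so that I \<subseteq> K can be tested on generators.\<close>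
  define K where "K = {p \<in> carrier (poly_ring r). \<forall>q. pairing F (p * q) = 0}"
  have "ideal K (poly_ring r)"
    by (rule ideal_poly_ringI)
      (auto simp: K_def carrier_poly_ring_0 carrier_poly_ring_closed distrib_right pairing_add mult.assoc mult.left_commute)
  moreover have "std_forms r i ^ Suc m \<in> K" for i
    using std_forms_power_carrier[of r i "Suc m"] F(2,3)
    by (cases "i < r") (simp_all add: K_def std_forms_def del: power_Suc)
  ultimately have "I \<subseteq> K" unfolding I_def by (rule power_ideal_subset)
  moreover have "h - l * f \<notin> K" for f
  proof
    assume "h - l * f \<in> K"
    then have "pairing F ((h - l * f) * 1) = 0" unfolding K_def by blast
    then show False using h F(1)[of f] pairing_add[of F h "- (l * f)"] by (simp add: pairing_uminus)
  qed
  ultimately show ?thesis using h(1) by blast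
qed

section \<open>Linear changes of coordinates\<close>

definition mono_eval :: "('v \<Rightarrow> 'b::comm_ring_1) \<Rightarrow> ('v \<Rightarrow>\<^sub>0 nat) \<Rightarrow> 'b" where
  "mono_eval x \<alpha> = (\<Prod>v\<in>keys \<alpha>. x v ^ lookup \<alpha> v)"

lemma mono_eval_superset:
  "finite S \<Longrightarrow> keys \<alpha> \<subseteq> S \<Longrightarrow> mono_eval x \<alpha> = (\<Prod>v\<in>S. x v ^ lookup \<alpha> v)"
  unfolding mono_eval_def by (rule prod.mono_neutral_left) (auto simp: in_keys_iff)

lemma mono_eval_add: "mono_eval x (\<alpha> + \<beta>) = mono_eval x \<alpha> * mono_eval x \<beta>"
  using Poly_Mapping.keys_add[of \<alpha> \<beta>]
  by (simp add: mono_eval_superset[of "keys \<alpha> \<union> keys \<beta>"] lookup_add power_add prod.distrib)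

lemma mono_eval_0 [simp]: "mono_eval x 0 = 1"
  by (simp add: mono_eval_def)

lemma mono_eval_single: "mono_eval x (single i n) = x i ^ n"
  by (simp add: mono_eval_superset[of "{i}"])

text \<open>The coefficient map \<open>c\<close> lets one definition serve both for substituting
  polynomials (\<open>c = const\<close>) and for evaluating at scalars (\<open>c\<close> the
  identity).\<close>

definition insertion :: "('a \<Rightarrow> 'b) \<Rightarrow> ('v \<Rightarrow> 'b::comm_ring_1) \<Rightarrow> ('v, 'a::comm_ring_1) mpoly \<Rightarrow> 'b" where
  "insertion c x p = (\<Sum>\<alpha>\<in>keys p. c (lookup p \<alpha>) * mono_eval x \<alpha>)"

context
  fixes c :: "'a::comm_ring_1 \<Rightarrow> 'b::comm_ring_1" and x :: "'v \<Rightarrow> 'b"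
  assumes c: "comm_ring_hom c"
begin

interpretation c: comm_ring_hom c by (rule c)

lemma insertion_superset:
  "finite S \<Longrightarrow> keys p \<subseteq> S \<Longrightarrow> insertion c x p = (\<Sum>\<alpha>\<in>S. c (lookup p \<alpha>) * mono_eval x \<alpha>)"
  unfolding insertion_def by (rule sum.mono_neutral_left) (auto simp: in_keys_iff)

lemma insertion_add: "insertion c x (p + q) = insertion c x p + insertion c x q"
  using Poly_Mapping.keys_add[of p q]
  by (simp add: insertion_superset[of "keys p \<union> keys q"] lookup_add c.hom_add distrib_right sum.distrib)

lemma insertion_0: "insertion c x 0 = 0"
  by (simp add: insertion_def)

lemma insertion_single: "insertion c x (single \<alpha> a) = c a * mono_eval x \<alpha>"
  by (simp add: insertion_superset[of "{\<alpha>}"])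

lemma insertion_mult: "insertion c x (p * q) = insertion c x p * insertion c x q"
proof (induction p rule: poly_mapping_additive_induct)
  case (add p p')
  then show ?case by (simp add: insertion_add distrib_right)
next
  case (single \<alpha> a)
  show ?case
  proof (induction q rule: poly_mapping_additive_induct)
    case (add p p')
    then show ?case by (simp add: insertion_add distrib_left)
  next
    case (single \<beta> b)
    show ?case
      by (simp add: mult_single insertion_single mono_eval_add c.hom_mult ac_simps)
  qed (simp add: insertion_0)
qed (simp add: insertion_0)

lemma insertion_hom: "comm_ring_hom (insertion c x)"
proof
  show "insertion c x 1 = 1" using insertion_single[of 0 1] by simp
qed (simp_all add: insertion_add insertion_mult insertion_0)

lemma insertion_var: "insertion c x (var i) = x i"
  by (simp add: var_def insertion_single mono_eval_single)

lemma insertion_const: "insertion c x (const a) = c a"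
  by (simp add: const_def insertion_single)

end

lemma const_hom: "comm_ring_hom const"
  by unfold_locales (simp_all add: const_add const_mult)

lemma id_hom: "comm_ring_hom (\<lambda>a. a)"
  by unfold_locales simp_all

lemma eval_mpoly_eq_insertion: "eval_mpoly x p = insertion (\<lambda>a. a) x p"
  by (simp add: eval_mpoly_def insertion_def mono_eval_def)

lemma mono_eval_var: "mono_eval var \<alpha> = single \<alpha> 1"
proof (induction \<alpha> rule: poly_mapping_additive_induct)
  case (add \<alpha> \<beta>)
  then show ?case by (simp add: mono_eval_add mult_single)
qed (simp_all add: mono_eval_single var_power)

lemma insertion_var_id: "insertion const var p = p"
  unfolding insertion_def mono_eval_var const_mult_single
  using poly_mapping_sum_single[of p] by simp

section \<open>Substitution of linear forms\<close>

abbreviation subst :: "(nat \<Rightarrow> (nat, 'a::comm_ring_1) mpoly) \<Rightarrow> (nat, 'a) mpoly \<Rightarrow> (nat, 'a) mpoly" where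
  "subst \<equiv> insertion const"

lemmas subst_add = insertion_add[OF const_hom] and subst_mult = insertion_mult[OF const_hom]
  and subst_var = insertion_var[OF const_hom] and subst_const = insertion_const[OF const_hom]
  and subst_single = insertion_single[OF const_hom]

interpretation subst: comm_ring_hom "subst \<theta>" for \<theta>
  by (rule insertion_hom[OF const_hom])

lemma subst_mono_eval: "subst \<theta> (mono_eval x \<alpha>) = mono_eval (\<lambda>i. subst \<theta> (x i)) \<alpha>"
  by (simp add: mono_eval_def subst.hom_prod subst.hom_power)

lemma subst_subst: "subst \<theta> (subst \<eta> p) = subst (\<lambda>i. subst \<theta> (\<eta> i)) p"
  by (simp add: insertion_def[of const \<eta>] insertion_def[of const "\<lambda>i. subst \<theta> (\<eta> i)"]
      subst.hom_sum subst_mult subst_const subst_mono_eval)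

lemma subst_cong:
  assumes "p \<in> carrier (poly_ring r)" "\<And>i. i < r \<Longrightarrow> \<theta> i = \<eta> i"
  shows "subst \<theta> p = subst \<eta> p"
proof -
  have "mono_eval \<theta> \<alpha> = mono_eval \<eta> \<alpha>" if "\<alpha> \<in> keys p" for \<alpha>
    unfolding mono_eval_def by (rule prod.cong) (use that assms in \<open>auto simp: carrier_poly_ring indets_def\<close>)
  then show ?thesis by (simp add: insertion_def)
qed

lemma mono_eval_homogeneous:
  assumes "\<And>i. i \<in> keys \<alpha> \<Longrightarrow> \<theta> i \<in> homogeneous_part r 1"
  shows "mono_eval \<theta> \<alpha> \<in> homogeneous_part r (mdegree \<alpha>)"
proof -
  have "(\<Prod>v\<in>S. \<theta> v ^ lookup \<alpha> v) \<in> homogeneous_part r (\<Sum>v\<in>S. lookup \<alpha> v)" if "finite S" "S \<subseteq> keys \<alpha>" for S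
    using that
  proof (induction S rule: finite_induct)
    case (insert v S)
    then have "\<theta> v ^ lookup \<alpha> v \<in> homogeneous_part r (lookup \<alpha> v * 1)"
      by (intro homogeneous_part_power assms) auto
    then show ?case using insert by (simp add: homogeneous_part_mult)
  qed (simp add: homogeneous_part_1)
  from this[of "keys \<alpha>"] show ?thesis by (simp add: mono_eval_def mdegree_def)
qed

lemma subst_homogeneous:
  assumes p: "p \<in> homogeneous_part r d" and \<theta>: "\<And>i. i < r \<Longrightarrow> \<theta> i \<in> homogeneous_part r 1"
  shows "subst \<theta> p \<in> homogeneous_part r d"
  unfolding insertion_def
proof (intro homogeneous_part_sum homogeneous_part_const_mult)
  fix \<alpha> assume "\<alpha> \<in> keys p"
  then have "keys \<alpha> \<subseteq> {..<r}" "mdegree \<alpha> = d" using p by (auto simp: mem_homogeneous_part)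
  then show "mono_eval \<theta> \<alpha> \<in> homogeneous_part r d"
    using mono_eval_homogeneous[of \<alpha> \<theta> r] \<theta> by auto
qed

lemma subst_carrier:
  assumes p: "p \<in> carrier (poly_ring r)" and \<theta>: "\<And>i. i < r \<Longrightarrow> \<theta> i \<in> homogeneous_part r 1"
  shows "subst \<theta> p \<in> carrier (poly_ring r)"
  unfolding insertion_def carrier_poly_ring mem_Collect_eq
proof (rule indets_sum)
  fix \<alpha> assume "\<alpha> \<in> keys p"
  then have "keys \<alpha> \<subseteq> {..<r}" using p by (auto simp: carrier_poly_ring indets_def)
  then have "mono_eval \<theta> \<alpha> \<in> homogeneous_part r (mdegree \<alpha>)" using mono_eval_homogeneous[of \<alpha> \<theta> r] \<theta> by auto
  then show "indets (const (lookup p \<alpha>) * mono_eval \<theta> \<alpha>) \<subseteq> {..<r}"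
    using homogeneous_part_carrier indets_mult[of "const (lookup p \<alpha>)" "mono_eval \<theta> \<alpha>"]
    by (fastforce simp: carrier_poly_ring)
qed

lemma subst_linform: "subst \<theta> (linform r c) = (\<Sum>i<r. const (c i) * \<theta> i)"
  by (simp add: linform_def subst.hom_sum subst_mult subst_const subst_var)

lemma const_sum: "const (sum f A) = (\<Sum>a\<in>A. const (f a))"
  by (induction A rule: infinite_finite_induct) (simp_all add: const_add)

lemma const_sum_swap:
  fixes y :: "nat \<Rightarrow> (nat, 'a::comm_ring_1) mpoly" and r s :: nat
  shows "(\<Sum>j<r. const (b j) * (\<Sum>i<s. const (B j i) * y i)) = (\<Sum>i<s. const (\<Sum>j<r. b j * B j i) * y i)"
proof -
  have "(\<Sum>j<r. const (b j) * (\<Sum>i<s. const (B j i) * y i)) = (\<Sum>j<r. \<Sum>i<s. const (b j * B j i) * y i)"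
    by (simp add: sum_distrib_left const_mult mult.assoc)
  also have "\<dots> = (\<Sum>i<s. \<Sum>j<r. const (b j * B j i) * y i)"
    by (rule sum.swap)
  also have "\<dots> = (\<Sum>i<s. const (\<Sum>j<r. b j * B j i) * y i)"
    by (simp add: const_sum sum_distrib_right)
  finally show ?thesis .
qed

lemma const_delta_sum:
  fixes y :: "nat \<Rightarrow> (nat, 'a::comm_ring_1) mpoly" and r :: nat
  assumes "i < r" "\<And>j. j < r \<Longrightarrow> b j = (if j = i then 1 else 0)"
  shows "(\<Sum>j<r. const (b j) * y j) = y i"
proof -
  have "(\<Sum>j<r. const (b j) * y j) = (\<Sum>j<r. if j = i then y j else 0)"
    by (rule sum.cong) (auto simp: assms(2))
  then show ?thesis using assms(1) by simp
qed

text \<open>The substitution x_i -> a_i l_i sends L to \<Sum> a_i l_i = l_r. Up to nonzero scalars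
  it therefore carries the standard forms to the given ones, and one power ideal to the
  other.\<close>

lemma not_weak_lefschetz_in_degree_general:
  fixes l :: "nat \<Rightarrow> (nat, 'a::field_char_0) mpoly"
  assumes k: "k \<ge> 2" "m \<ge> 3" and c: "Suc c = k * m" and r: "r = 2 * k"
    and l: "\<And>i. i < r \<Longrightarrow> l i = linform r (A i)"
    and AB: "\<And>i i'. i < r \<Longrightarrow> i' < r \<Longrightarrow> (\<Sum>j<r. A i j * B j i') = (if i' = i then 1 else 0)"
    and BA: "\<And>j j'. j < r \<Longrightarrow> j' < r \<Longrightarrow> (\<Sum>i<r. B j i * A i j') = (if j' = j then 1 else 0)"
    and a: "\<And>i. i < r \<Longrightarrow> a i \<noteq> 0" and lr: "l r = (\<Sum>i<r. const (a i) * l i)"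
  shows "\<not> weak_lefschetz_in_degree r (power_ideal r (r + 1) (Suc m) l) c"
proof -
  define I where "I = power_ideal r (r + 1) (Suc m) l"
  define I0 :: "(nat, 'a) mpoly set" where "I0 = power_ideal r (r + 1) (Suc m) (std_forms r)"
  define \<theta> where "\<theta> i = const (a i) * l i" for i
  \<comment> \<open>The inverse substitution: \<open>B\<close> expresses the variables through the
    l_i, and division by a_i undoes the scaling.\<close>
  define \<eta> where "\<eta> j = linform r (\<lambda>i. B j i / a i)" for j
  define b where "b i = (if i < r then a i else 1)" for i
  have b: "b i \<noteq> 0" for i using a by (simp add: b_def)
  have l1: "l i \<in> homogeneous_part r 1" if "i < r + 1" for i
  proof (cases "i < r")
    case False
    then have "i = r" using that by simp
    moreover have "(\<Sum>i<r. const (a i) * l i) \<in> homogeneous_part r 1"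
      by (intro homogeneous_part_sum homogeneous_part_const_mult) (simp add: l linform_homogeneous del: One_nat_def)
    ultimately show ?thesis by (simp only: lr)
  qed (simp add: l linform_homogeneous del: One_nat_def)
  have \<theta>1: "\<theta> i \<in> homogeneous_part r 1" if "i < r" for i
    unfolding \<theta>_def using that by (intro homogeneous_part_const_mult l1) simp
  have \<eta>1: "\<eta> i \<in> homogeneous_part r 1" for i
    unfolding \<eta>_def by (rule linform_homogeneous)
  have \<theta>\<eta>: "subst \<theta> (\<eta> j) = var j" if j: "j < r" for j
  proof -
    have "subst \<theta> (\<eta> j) = (\<Sum>i<r. const (B j i) * (\<Sum>j'<r. const (A i j') * var j'))"
      unfolding \<eta>_def subst_linform \<theta>_def
      by (rule sum.cong[OF refl]) (simp add: l linform_def a flip: const_mult mult.assoc)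
    also have "\<dots> = var j"
      unfolding const_sum_swap by (rule const_delta_sum[OF j]) (use BA j in simp)
    finally show ?thesis .
  qed
  have \<eta>l: "subst \<eta> (l i) = const (1 / a i) * var i" if i: "i < r" for i
  proof -
    have "subst \<eta> (l i) = (\<Sum>j<r. const (A i j) * (\<Sum>i'<r. const (B j i') * (const (1 / a i') * var i')))"
      unfolding l[OF i] subst_linform unfolding \<eta>_def linform_def
      by (simp flip: const_mult mult.assoc)
    also have "\<dots> = const (1 / a i) * var i"
      unfolding const_sum_swap by (rule const_delta_sum[OF i]) (use AB i in simp)
    finally show ?thesis .
  qed
  have \<eta>l_std: "subst \<eta> (l i) = const (1 / b i) * std_forms r i" if "i < r + 1" for i
  proof (cases "i < r")
    case False
    then have [simp]: "i = r" using that by simp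
    have "subst \<eta> (l r) = (\<Sum>i<r. const (a i) * (const (1 / a i) * var i))"
      unfolding lr by (simp add: subst.hom_sum subst_mult subst_const \<eta>l)
    also have "\<dots> = varsum r"
      unfolding linform_def by (rule sum.cong[OF refl]) (simp add: a flip: const_mult mult.assoc)
    finally show ?thesis by (simp add: b_def std_forms_def)
  qed (simp add: \<eta>l b_def std_forms_def)
  have \<theta>_std: "subst \<theta> (std_forms r i) = const (b i) * l i" if "i < r + 1" for i
  proof (cases "i < r")
    case False
    then have [simp]: "i = r" using that by simp
    show ?thesis by (simp add: std_forms_def subst_linform \<theta>_def b_def lr)
  qed (simp add: std_forms_def subst_var \<theta>_def b_def)
  have \<eta>\<theta>: "subst \<eta> (\<theta> i) = var i" if "i < r" for i
    using that by (simp add: \<theta>_def subst_mult subst_const \<eta>l a flip: const_mult mult.assoc)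
  have inv1: "subst \<theta> (subst \<eta> p) = p" if "p \<in> carrier (poly_ring r)" for p
    unfolding subst_subst using subst_cong[OF that, of "\<lambda>i. subst \<theta> (\<eta> i)" var] \<theta>\<eta> insertion_var_id by auto
  have inv2: "subst \<eta> (subst \<theta> p) = p" if "p \<in> carrier (poly_ring r)" for p
    unfolding subst_subst using subst_cong[OF that, of "\<lambda>i. subst \<eta> (\<theta> i)" var] \<eta>\<theta> insertion_var_id by auto
  have I: "ideal I (poly_ring r)" and gen: "\<And>i. i < r + 1 \<Longrightarrow> l i ^ Suc m \<in> I"
    unfolding I_def using ideal_power_ideal[of "r + 1" l r] homogeneous_part_carrier[OF l1] by blast+
  have I0: "ideal I0 (poly_ring r)" and gen0: "\<And>i. i < r + 1 \<Longrightarrow> std_forms r i ^ Suc m \<in> I0"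
    unfolding I0_def using ideal_power_ideal[of "r + 1" "std_forms r" r] homogeneous_part_carrier[OF std_forms_homogeneous] by blast+
  \<comment> \<open>Preimages of ideals under a linear substitution are ideals, so each inclusion
    between the power ideals has to be checked on generators only.\<close>
  have preimage: "ideal {p \<in> carrier (poly_ring r). subst \<xi> p \<in> J} (poly_ring r)"
    if J: "ideal J (poly_ring r)" and \<xi>: "\<And>i. i < r \<Longrightarrow> \<xi> i \<in> homogeneous_part r 1" for J and \<xi> :: "nat \<Rightarrow> (nat, 'a) mpoly"
    using ideal_poly_ring_closed(2,3,4)[OF J] subst_carrier[OF _ \<xi>]
    by (intro ideal_poly_ringI) (auto simp: carrier_poly_ring_0 carrier_poly_ring_closed subst_add subst_mult)
  have power: "const x ^ n \<in> carrier (poly_ring r)" for x :: 'a and n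
    by (rule carrier_poly_ring_power) (simp add: carrier_poly_ring)
  have "I \<subseteq> {p \<in> carrier (poly_ring r). subst \<eta> p \<in> I0}"
    unfolding I_def
  proof (rule power_ideal_subset[OF preimage[OF I0 \<eta>1]])
    fix i assume i: "i < r + 1"
    have "subst \<eta> (l i ^ Suc m) = const (1 / b i) ^ Suc m * std_forms r i ^ Suc m"
      unfolding subst.hom_power \<eta>l_std[OF i] by (rule power_mult_distrib)
    also have "\<dots> \<in> I0" by (rule ideal_poly_ring_closed(4)[OF I0 gen0[OF i] power])
    finally show "l i ^ Suc m \<in> {p \<in> carrier (poly_ring r). subst \<eta> p \<in> I0}"
      using carrier_poly_ring_power[OF homogeneous_part_carrier[OF l1[OF i]]] by blast
  qed
  then have to_std: "subst \<eta> p \<in> I0" if "p \<in> I" for p using that by blast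
  have "I0 \<subseteq> {p \<in> carrier (poly_ring r). subst \<theta> p \<in> I}"
    unfolding I0_def
  proof (rule power_ideal_subset[OF preimage[OF I \<theta>1]])
    fix i assume i: "i < r + 1"
    have "subst \<theta> (std_forms r i ^ Suc m) = const (b i) ^ Suc m * l i ^ Suc m"
      unfolding subst.hom_power \<theta>_std[OF i] by (rule power_mult_distrib)
    also have "\<dots> \<in> I" by (rule ideal_poly_ring_closed(4)[OF I gen[OF i] power])
    finally show "std_forms r i ^ Suc m \<in> {p \<in> carrier (poly_ring r). subst \<theta> p \<in> I}"
      using std_forms_power_carrier by blast
  qed
  then have from_std: "subst \<theta> p \<in> I" if "p \<in> I0" for p using that by blast
  show ?thesis
    unfolding I_def[symmetric]
  proof (rule not_weak_lefschetz_in_degreeI[OF I])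
    \<comment> \<open>Both witnesses are found for the transformed form \<eta>(f) in the standard
      ring and carried back by \<theta>.\<close>
    fix f :: "(nat, 'a) mpoly" assume f: "f \<in> homogeneous_part r 1"
    then have f': "subst \<eta> f \<in> homogeneous_part r 1" using \<eta>1 by (rule subst_homogeneous)
    have f_eq: "subst \<theta> (subst \<eta> f) = f" by (rule inv1[OF homogeneous_part_carrier[OF f]])
    obtain g where g: "g \<in> homogeneous_part r c" "g \<notin> I0" "subst \<eta> f * g \<in> I0"
      using std_not_injective[OF k c r f'] unfolding I0_def by blast
    have "subst \<theta> g \<in> homogeneous_part r c" using g(1) \<theta>1 by (rule subst_homogeneous)
    moreover have "subst \<theta> g \<notin> I" using to_std[of "subst \<theta> g"] g inv2[OF homogeneous_part_carrier[OF g(1)]] by auto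
    moreover have "f * subst \<theta> g \<in> I" using from_std[OF g(3)] by (simp add: subst_mult f_eq)
    ultimately show "\<exists>g\<in>homogeneous_part r c. g \<notin> I \<and> f * g \<in> I" by blast
    obtain h where h: "h \<in> homogeneous_part r (Suc c)" "\<And>g. h - subst \<eta> f * g \<notin> I0"
      using std_not_surjective[OF r f', of m] unfolding I0_def c by blast
    have "subst \<theta> h \<in> homogeneous_part r (Suc c)" using h(1) \<theta>1 by (rule subst_homogeneous)
    moreover have "subst \<theta> h - f * g \<notin> I" for g
      using to_std[of "subst \<theta> h - f * g"] h(2)[of "subst \<eta> g"] inv2[OF homogeneous_part_carrier[OF h(1)]]
      by (auto simp: subst.hom_minus subst_mult)
    ultimately show "\<exists>h\<in>homogeneous_part r (Suc c). \<forall>g\<in>homogeneous_part r c. h - f * g \<notin> I" by blast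
  qed
qed

section \<open>Genericity\<close>

text \<open>The forms are the columns, hence the swapped indices: solving M y =
  \<open>last_form r x\<close> expresses the last form through the others.\<close>

definition form_matrix :: "nat \<Rightarrow> (nat \<times> nat \<Rightarrow> 'b) \<Rightarrow> 'b mat" where
  "form_matrix r x = mat r r (\<lambda>(j, i). x (i, j))"

definition last_form :: "nat \<Rightarrow> (nat \<times> nat \<Rightarrow> 'b) \<Rightarrow> 'b vec" where
  "last_form r x = vec r (\<lambda>j. x (r, j))"

text \<open>By Cramer's rule, its nonvanishing at the coordinates of a tuple of forms says that the first
  \<open>r\<close> forms are a basis in which all coordinates of the last form are nonzero.\<close>

definition generic_poly :: "nat \<Rightarrow> (nat \<times> nat \<Rightarrow> 'b::comm_ring_1) \<Rightarrow> 'b" where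
  "generic_poly r x = det (form_matrix r x) *
    (\<Prod>i<r. det (replace_col (form_matrix r x) (last_form r x) i))"

lemma form_matrix_carrier: "form_matrix r x \<in> carrier_mat r r"
  and last_form_carrier: "last_form r x \<in> carrier_vec r"
  by (simp_all add: form_matrix_def last_form_def)

text \<open>At \<open>var\<close> the expression is the polynomial that cuts out the open set, at
  the coordinates of a tuple it is a scalar; this compatibility with ring homomorphisms makes the
  scalar the value of the polynomial.\<close>

lemma (in comm_ring_hom) hom_generic_poly:
  "hom (generic_poly r x) = generic_poly r (\<lambda>v. hom (x v))"
proof -
  have "map_mat hom (form_matrix r x) = form_matrix r (\<lambda>v. hom (x v))"
    by (rule eq_matI) (auto simp: form_matrix_def)
  moreover have "map_mat hom (replace_col (form_matrix r x) (last_form r x) i)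
      = replace_col (form_matrix r (\<lambda>v. hom (x v))) (last_form r (\<lambda>v. hom (x v))) i" for i
    by (rule eq_matI) (auto simp: form_matrix_def last_form_def replace_col_def)
  ultimately show ?thesis
    by (simp add: generic_poly_def hom_mult hom_prod flip: hom_det)
qed

lemma indets_det:
  assumes A: "A \<in> carrier_mat n n" and V: "\<And>i j. i < n \<Longrightarrow> j < n \<Longrightarrow> indets (A $$ (i, j)) \<subseteq> V"
  shows "indets (det A :: ('v, 'a::comm_ring_1) mpoly) \<subseteq> V"
  unfolding det_def'[OF A]
proof (rule indets_sum)
  fix p assume "p \<in> {p. p permutes {0..<n}}"
  then have "p i < n" if "i < n" for i using that permutes_in_image[of p "{0..<n}" i] by auto
  then have "indets (\<Prod>i = 0..<n. A $$ (i, p i)) \<subseteq> V" by (intro indets_prod V) auto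
  then show "indets (signof p * (\<Prod>i = 0..<n. A $$ (i, p i))) \<subseteq> V"
    by (auto simp: sign_def)
qed

lemma indets_generic_poly: "indets (generic_poly r var) \<subseteq> {..<r + 1} \<times> {..<r}"
proof -
  have var: "indets (var (i, j)) \<subseteq> {..<r + 1} \<times> {..<r}" if "i < r + 1" "j < r" for i j
    using indets_var[of "(i, j)"] that by auto
  have "indets (det (form_matrix r var)) \<subseteq> {..<r + 1} \<times> {..<r}"
    by (rule indets_det[OF form_matrix_carrier]) (simp add: form_matrix_def var[simplified])
  moreover have "indets (\<Prod>i<r. det (replace_col (form_matrix r var) (last_form r var) i)) \<subseteq> {..<r + 1} \<times> {..<r}"
  proof (rule indets_prod, rule indets_det)
    show "replace_col (form_matrix r var) (last_form r var) i \<in> carrier_mat r r" for i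
      by (simp add: replace_col_def form_matrix_def)
  qed (simp add: form_matrix_def last_form_def replace_col_def var[simplified])
  ultimately show ?thesis
    unfolding generic_poly_def by (intro order.trans[OF indets_mult] Un_least)
qed

lemma eval_generic_poly: "eval_mpoly x (generic_poly r var) = generic_poly r x"
proof -
  interpret comm_ring_hom "insertion (\<lambda>a. a) x" by (rule insertion_hom[OF id_hom])
  show ?thesis by (simp add: eval_mpoly_eq_insertion hom_generic_poly insertion_var[OF id_hom])
qed

lemma generic_polyD:
  fixes x :: "nat \<times> nat \<Rightarrow> 'a::field"
  assumes "generic_poly r x \<noteq> 0"
  obtains B a where
    "\<And>i i'. i < r \<Longrightarrow> i' < r \<Longrightarrow> (\<Sum>j<r. x (i, j) * B j i') = (if i' = i then 1 else 0)"
    "\<And>j j'. j < r \<Longrightarrow> j' < r \<Longrightarrow> (\<Sum>i<r. B j i * x (i, j')) = (if j' = j then 1 else 0)"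
    "\<And>i. i < r \<Longrightarrow> a i \<noteq> 0"
    "\<And>j. j < r \<Longrightarrow> x (r, j) = (\<Sum>i<r. a i * x (i, j))"
proof -
  define M where "M = form_matrix r x"
  have M: "M \<in> carrier_mat r r" unfolding M_def by (rule form_matrix_carrier)
  have det: "det M \<noteq> 0" "\<And>i. i < r \<Longrightarrow> det (replace_col M (last_form r x) i) \<noteq> 0"
    using assms by (auto simp: generic_poly_def M_def)
  obtain N where N: "N \<in> carrier_mat r r" "M * N = 1\<^sub>m r" "N * M = 1\<^sub>m r"
    using det_non_zero_imp_unit[OF M det(1)] unfolding Units_def ring_mat_def by auto
  define y where "y = N *\<^sub>v last_form r x"
  have y: "y \<in> carrier_vec r" using N by (simp add: y_def mult_mat_vec_carrier last_form_carrier)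
  have My: "M *\<^sub>v y = last_form r x"
    unfolding y_def assoc_mult_mat_vec[OF M N(1) last_form_carrier, symmetric] N(2)
    by (rule one_mult_mat_vec[OF last_form_carrier])
  have Mx: "M $$ (j, i) = x (i, j)" if "i < r" "j < r" for i j
    using that by (simp add: M_def form_matrix_def)
  have prod: "(X * Y) $$ (i, j) = (\<Sum>l<r. X $$ (i, l) * Y $$ (l, j))"
    if "X \<in> carrier_mat r r" "Y \<in> carrier_mat r r" "i < r" "j < r" for X Y :: "'a mat" and i j
    using that by (auto simp: scalar_prod_def atLeast0LessThan intro!: sum.cong)
  show ?thesis
  \<comment> \<open>The matrix \<open>M\<close> is the transpose of the array x, so B is the
    transpose of N. Transposition reverses products: N M = 1 gives x B = 1, and M N = 1 gives B x =
    1.\<close>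
  proof (rule that[of "\<lambda>j i. N $$ (i, j)" "\<lambda>i. y $ i"])
    fix i i' assume i: "i < r" "i' < r"
    have "(N * M) $$ (i', i) = (if i' = i then 1 else 0)" using N(3) i by simp
    then show "(\<Sum>j<r. x (i, j) * N $$ (i', j)) = (if i' = i then 1 else 0)"
      using prod[OF N(1) M i(2,1)] i Mx by (simp add: mult.commute)
    have "(M * N) $$ (i', i) = (if i' = i then 1 else 0)" using N(2) i by simp
    then show "(\<Sum>l<r. N $$ (l, i) * x (l, i')) = (if i' = i then 1 else 0)"
      using prod[OF M N(1) i(2,1)] i Mx by (simp add: mult.commute)
  next
    fix i assume i: "i < r"
    show "y $ i \<noteq> 0" using cramer_lemma_mat[OF M y i] det(2)[OF i] unfolding My by auto
  next
    fix j assume j: "j < r"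
    have "x (r, j) = (M *\<^sub>v y) $ j" unfolding My using j by (simp add: last_form_def)
    also have "\<dots> = (\<Sum>i<r. y $ i * x (i, j))"
      using j y M Mx by (auto simp: scalar_prod_def atLeast0LessThan mult.commute intro!: sum.cong)
    finally show "x (r, j) = (\<Sum>i<r. y $ i * x (i, j))" .
  qed
qed

text \<open>Provides a point of the open set: the matrix is the identity, and by Cramer's rule the
  other determinants are the coordinates of the last form, all equal to 1.\<close>

lemma generic_poly_std_forms:
  "generic_poly r (tuple_coords (std_forms r)) = (1 :: 'a::comm_ring_1)"
proof -
  let ?x = "tuple_coords (std_forms r) :: nat \<times> nat \<Rightarrow> 'a"
  have expo_eq: "expo j = expo i \<longleftrightarrow> i = j" for i j :: nat
    by (metis lookup_single_eq lookup_single_not_eq nat.distinct(1))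
  have x: "?x (i, j) = (if i < r then (if i = j then 1 else 0) else 1)" if "j < r" for i j
    using that
    by (auto simp: tuple_coords_def std_forms_def var_def lookup_single when_def expo_eq linform_def lookup_sum)
  have M: "form_matrix r ?x = 1\<^sub>m r"
    by (rule eq_matI) (auto simp: form_matrix_def x)
  have "det (replace_col (1\<^sub>m r) (last_form r ?x) i) = 1" if i: "i < r" for i
    using cramer_lemma_mat[OF one_carrier_mat last_form_carrier i, of ?x] i by (simp add: last_form_carrier) (simp add: last_form_def x)
  then show ?thesis by (simp add: generic_poly_def M)
qed

theorem theorem1p4:
  fixes k r :: nat
  assumes "k \<ge> 2" and "r = 2 * k"
  shows "\<exists>t0. \<forall>t\<ge>t0.
    for_generic_forms r (r + 1) (\<lambda>l :: nat \<Rightarrow> (nat, 'a::field_char_0) mpoly.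
      \<not> weak_lefschetz_in_degree r (power_ideal r (r + 1) t l) (r div 2 * (t - 1) - 1))"
proof (intro exI[of _ 4] allI impI)
  \<comment> \<open>The bound t \<ge> 4 means m \<ge> 3, as the case k = 2 of the inequality between
    counts requires; it serves every k.\<close>
  fix t :: nat assume t: "t \<ge> 4"
  define m where "m = t - 1"
  have m: "m \<ge> 3" "t = Suc m" using t by (auto simp: m_def)
  define U :: "(nat \<Rightarrow> (nat, 'a) mpoly) set" where
    "U = linear_form_tuples r (r + 1) - {l \<in> linear_form_tuples r (r + 1).
      \<forall>p\<in>{generic_poly r var}. eval_mpoly (tuple_coords l) p = 0}"
  show "for_generic_forms r (r + 1) (\<lambda>l :: nat \<Rightarrow> (nat, 'a) mpoly.
      \<not> weak_lefschetz_in_degree r (power_ideal r (r + 1) t l) (r div 2 * (t - 1) - 1))"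
    unfolding for_generic_forms_def
  proof (intro exI[of _ U] conjI ballI)
    show "zariski_open r (r + 1) U"
      unfolding zariski_open_def U_def using indets_generic_poly by (intro exI[of _ "{generic_poly r var}"]) auto
    \<comment> \<open>Tuples are extensional functions, hence the restriction to the index
      set.\<close>
    let ?l = "restrict (std_forms r) {..<r + 1} :: nat \<Rightarrow> (nat, 'a) mpoly"
    have "?l \<in> linear_form_tuples r (r + 1)"
      unfolding linear_form_tuples_def using std_forms_homogeneous by auto
    moreover have "generic_poly r (tuple_coords ?l) = generic_poly r (tuple_coords (std_forms r))"
    proof -
      have "form_matrix r (tuple_coords ?l) = form_matrix r (tuple_coords (std_forms r) :: _ \<Rightarrow> 'a)"
        by (rule eq_matI) (auto simp: form_matrix_def tuple_coords_def)
      moreover have "last_form r (tuple_coords ?l) = last_form r (tuple_coords (std_forms r) :: _ \<Rightarrow> 'a)"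
        by (rule eq_vecI) (auto simp: last_form_def tuple_coords_def)
      ultimately show ?thesis by (simp add: generic_poly_def)
    qed
    ultimately have "?l \<in> U" by (simp add: U_def eval_generic_poly generic_poly_std_forms)
    then show "U \<noteq> {}" by blast
  next
    fix l assume "l \<in> U"
    then have l: "l \<in> linear_form_tuples r (r + 1)" and gen: "generic_poly r (tuple_coords l) \<noteq> 0"
      by (auto simp: U_def eval_generic_poly)
    have lin: "l i = linform r (\<lambda>j. tuple_coords l (i, j))" if "i < r + 1" for i
    proof -
      have "l i \<in> homogeneous_part r 1"
        using PiE_mem[OF l[unfolded linear_form_tuples_def], of i] that by simp
      from homogeneous_part_1_linform[OF this] show ?thesis
        unfolding tuple_coords_def prod.case One_nat_def .
    qed
    obtain B a where AB: "\<And>i i'. i < r \<Longrightarrow> i' < r \<Longrightarrow> (\<Sum>j<r. tuple_coords l (i, j) * B j i') = (if i' = i then 1 else 0)"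
      and BA: "\<And>j j'. j < r \<Longrightarrow> j' < r \<Longrightarrow> (\<Sum>i<r. B j i * tuple_coords l (i, j')) = (if j' = j then 1 else 0)"
      and a: "\<And>i. i < r \<Longrightarrow> a i \<noteq> 0"
      and lr: "\<And>j. j < r \<Longrightarrow> tuple_coords l (r, j) = (\<Sum>i<r. a i * tuple_coords l (i, j))"
      using generic_polyD[OF gen] by blast
    have "l r = (\<Sum>j<r. const (\<Sum>i<r. a i * tuple_coords l (i, j)) * var j)"
      using lin[of r] by (simp add: linform_def lr)
    also have "\<dots> = (\<Sum>i<r. const (a i) * (\<Sum>j<r. const (tuple_coords l (i, j)) * var j))"
      by (rule const_sum_swap[symmetric])
    also have "\<dots> = (\<Sum>i<r. const (a i) * l i)"
      by (rule sum.cong[OF refl]) (simp add: lin linform_def)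
    finally have lr': "l r = (\<Sum>i<r. const (a i) * l i)" .
    \<comment> \<open>Guarantees that the degree \<open>k * m - 1\<close> is a true predecessor of
      the middle degree.\<close>
    have "k * m \<noteq> 0" using assms m by simp
    then have "Suc (k * m - 1) = k * m" by simp
    then have "\<not> weak_lefschetz_in_degree r (power_ideal r (r + 1) (Suc m) l) (k * m - 1)"
      by (rule not_weak_lefschetz_in_degree_general[OF assms(1) m(1) _ assms(2) _ AB BA a lr'])
        (use lin in auto)
    then show "\<not> weak_lefschetz_in_degree r (power_ideal r (r + 1) t l) (r div 2 * (t - 1) - 1)"
      using assms(2) m by simp
  qed
qed

end
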